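(* Let $\Delta\subset\mathfrak t^*$ be a simple (or smooth) polytope. Let $I\in\mathcal I$ be an equivalence class of facets and define $I'=I\smallsetminus\{n\}$ for some $n\in I$. (i) If $F_I=\emptyset$, then $\Delta$ is an $F_{I'}$ bundle over the simplex $\Delta_{|I|-1}$ with base facets $\{F_i\}_{i\in I}$. (ii) If $F_I\ne\emptyset$, then $\Delta$ is the $(|I|-1)$-fold expansion of $F_{I'}$ along $F_I=F_n\cap F_{I'}$ with base-type facets $\{F_i\}_{i\in I}$.
   Context: There are two versions, one for simple and one for smooth polytopes, with the notions below read accordingly. Let $\mathfrak t$ be a finite-dimensional real vector space with dual $\mathfrak t^*$ and pairing $\langle\cdot,\cdot\rangle$. A polytope is a bounded set $\Delta=\bigcap_{i=1}^N\{x\in\mathfrak t^*\mid\langle\eta_i,x\rangle\le\kappa_i\}$ with outward conormals $\eta_i\in\mathfrak t$ and support numbers $\kappa_i\in\mathbb R$, where $\Delta$ affinely spans $\mathfrak t^*$ and each facet $F_i=\Delta\cap\{\langle\eta_i,x\rangle=\kappa_i\}$ affinely spans a hyperplane. It is simple if exactly $\dim\mathfrak t$ facets meet at each vertex. Given an integer lattice $\ell\subset\mathfrak t$, a simple polytope is smooth if the conormals can be chosen in $\ell$ and, at each vertex, the primitive outward conormals of the facets meeting there form a basis of $\ell$. For $J\subset\{1,\dots,N\}$, $F_J=\bigcap_{j\in J}F_j$ (with $F_\emptyset=\Delta$); nonempty faces $F_J$ are regarded as simple (smooth) polytopes in their affine span, whose conormals are the images of the conormals of $\Delta$ in the quotient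 of $\mathfrak t$ by the span of $\{\eta_j\}_{j\in J}$. Polytopes are identified up to affine isomorphism (with linear part preserving the lattices in the smooth case). $\Delta_k$ is a $k$-simplex, i.e. a $k$-dimensional (smooth, in the smooth case) polytope with $k+1$ facets. Equivalence of facets. With the $\eta_i$ fixed, for $\kappa'\in\mathbb R^N$ let $\Delta(\kappa')=\bigcap_i\{\langle\eta_i,x\rangle\le\kappa'_i\}$, with facets $F_i(\kappa')$. The chamber $\mathcal C_\Delta\subset\mathbb R^N$ is the connected component containing $\kappa$ of the set of $\kappa'$ for which $\Delta(\kappa')$ is a simple polytope (with $N$ facets). A symmetry of a polytope is an affine map $a:\mathfrak t^*\to\mathfrak t^*$ taking it to itself; in the smooth case its linear part must induce an automorphism of the integer lattice. A robust symmetry of $\Delta$ is a linear map $\hat a:\mathfrak t^*\to\mathfrak t^*$ such that for every $\kappa'\in\mathcal C_\Delta$ there is a symmetry $a_{\kappa'}$ of $\Delta(\kappa')$ with associated linear map $\hat a$. Facets $F_i,F_j$ are equivalent if there is a robust symmetry $\hat a$ such that each $a_{\kappa'}$ takes $F_i(\kappa')$ to $F_j(\kappa')$. $\mathcal I$ is the set of equivalence classes, each viewed as a subset of $\{1,\dots,N\}$. Conormals are normalized so that for every robust symmetry $\hat a$ and every $i$ there is $j$ with $\hat a^*(\eta_i)=\eta_j$; in the smooth case they are the primitive ones. Bundle. Two polytopes are combinatorially equivalent if there is a bijection of facets $F_i\leftrightarrow F'_i$ with $\bigcap_{i\in J}F_i\ne\emptyset$ iff $\bigcap_{i\in J}F'_i\ne\emptyset$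 for all $J$. Let $\tilde\Delta\subset\tilde{\mathfrak t}^*$ and $\hat\Delta\subset\hat{\mathfrak t}^*$ be simple polytopes with facets $\tilde F_j,\hat F_i$ and outward conormals $\tilde\eta_j,\hat\eta_i$. $\Delta$ is a $\tilde\Delta$ bundle over $\hat\Delta$ if there is a short exact sequence $0\to\tilde{\mathfrak t}\xrightarrow{\iota}\mathfrak t\xrightarrow{\pi}\hat{\mathfrak t}\to0$ (of vector spaces, with lattices in the smooth case) such that $\Delta$ is combinatorially equivalent to $\tilde\Delta\times\hat\Delta$; the facet of $\Delta$ corresponding to $\tilde F_j\times\hat\Delta$ (a fiber facet) has outward conormal $\iota(\tilde\eta_j)$ for all $j$; and the outward conormal $\hat\eta'_i$ of the facet corresponding to $\tilde\Delta\times\hat F_i$ (a base facet) satisfies $\pi(\hat\eta'_i)=\hat\eta_i$ for all $i$. Expansion. For an integer $k\ge0$, $\Delta\subset\mathfrak t^*$ is the $k$-fold expansion of $\tilde\Delta=\bigcap_{j=1}^{\tilde N}\{x\in\tilde{\mathfrak t}^*\mid\langle\tilde\eta_j,x\rangle\le\tilde\kappa_j\}$ along its facet $\tilde F_1$ if there is an identification $\mathfrak t=\tilde{\mathfrak t}\oplus\mathbb R^k$ such that $\Delta=\bigcap_{j=2}^{\tilde N}\{x\mid\langle(\tilde\eta_j,0),x\rangle\le\tilde\kappa_j\}\cap\bigcap_{i=1}^{k+1}\{x\mid\langle\hat\eta_i,x\rangle\le\hat\kappa_i\}$, where $\hat\eta_i=(0,-e_i)$, $\hat\kappa_i=0$ for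 $1\le i\le k$, $\hat\eta_{k+1}=(\tilde\eta_1,\sum_{i=1}^ke_i)$ and $\hat\kappa_{k+1}=\tilde\kappa_1$. The facets with conormals $\hat\eta_1,\dots,\hat\eta_{k+1}$ are the base-type facets. In the simple (non-smooth) case conormals are only defined up to positive multiples, and the conormal equalities in the last two definitions are to hold for suitable choices. *)

theory Defs
  imports "HOL-Analysis.Analysis"
begin

(* Finite-dimensional real vector spaces are modelled as linear subspaces T of Euclidean
   spaces: this includes dimension 0 and permits dimensions that depend on the polytope. The dual
   space of T is represented by T itself, through the perfect pairing given by the inner product.

   A facet presentation consists of the space, the integer lattice (None for the version of
   the theory for simple polytopes, Some L for the version for smooth polytopes), the finite set
   that indexes the facets, the outward conormals and the support numbers. *)

record ('i, 'a) presentation =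
  vspace :: "'a set"
  vlattice :: "'a set option"
  index :: "'i set"
  conormal :: "'i \<Rightarrow> 'a"
  supp :: "'i \<Rightarrow> real"

definition body :: "('i, 'a::euclidean_space) presentation \<Rightarrow> 'a set" where
  "body P = {x \<in> vspace P. \<forall>i\<in>index P. conormal P i \<bullet> x \<le> supp P i}"

definition facet :: "('i, 'a::euclidean_space) presentation \<Rightarrow> 'i \<Rightarrow> 'a set" where
  "facet P i = body P \<inter> {x. conormal P i \<bullet> x = supp P i}"

definition face :: "('i, 'a::euclidean_space) presentation \<Rightarrow> 'i set \<Rightarrow> 'a set" where
  "face P J = body P \<inter> (\<Inter>j\<in>J. facet P j)"

(* The condition inj_on says that distinct indices name distinct facets. *)

definition is_polytope :: "('i, 'a::euclidean_space) presentation \<Rightarrow> bool" where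
  "is_polytope P \<longleftrightarrow>
     subspace (vspace P) \<and> finite (index P) \<and> bounded (body P) \<and>
     affine hull (body P) = vspace P \<and>
     (\<forall>i\<in>index P. conormal P i \<in> vspace P \<and> conormal P i \<noteq> 0 \<and>
        affine hull (facet P i) = {x \<in> vspace P. conormal P i \<bullet> x = supp P i}) \<and>
     inj_on (facet P) (index P)"

definition facets_at :: "('i, 'a::euclidean_space) presentation \<Rightarrow> 'a \<Rightarrow> 'i set" where
  "facets_at P v = {i \<in> index P. v \<in> facet P i}"

definition is_simple :: "('i, 'a::euclidean_space) presentation \<Rightarrow> bool" where
  "is_simple P \<longleftrightarrow> is_polytope P \<and>
     (\<forall>v. v extreme_point_of body P \<longrightarrow> card (facets_at P v) = dim (vspace P))"


definition int_span :: "'a::euclidean_space set \<Rightarrow> 'a set" where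
  "int_span B = {(\<Sum>b\<in>B. real_of_int (c b) *\<^sub>R b) | c. True}"

definition is_lattice_basis :: "'a::euclidean_space set \<Rightarrow> 'a set \<Rightarrow> 'a set \<Rightarrow> bool" where
  "is_lattice_basis T L B \<longleftrightarrow> independent B \<and> span B = T \<and> int_span B = L"

definition is_lattice :: "'a::euclidean_space set \<Rightarrow> 'a set \<Rightarrow> bool" where
  "is_lattice T L \<longleftrightarrow> (\<exists>B. is_lattice_basis T L B)"

definition primitive :: "'a::euclidean_space set \<Rightarrow> 'a \<Rightarrow> bool" where
  "primitive L v \<longleftrightarrow> v \<in> L \<and> v \<noteq> 0 \<and> (\<forall>w\<in>L. \<forall>m::nat. v = real m *\<^sub>R w \<longrightarrow> m = 1)"

(* The conormals that a presentation of a smooth polytope records are the primitive ones. *)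

definition is_smooth :: "('i, 'a::euclidean_space) presentation \<Rightarrow> 'a set \<Rightarrow> bool" where
  "is_smooth P L \<longleftrightarrow> is_simple P \<and> is_lattice (vspace P) L \<and>
     (\<forall>i\<in>index P. primitive L (conormal P i)) \<and>
     (\<forall>v. v extreme_point_of body P \<longrightarrow>
        is_lattice_basis (vspace P) L (conormal P ` facets_at P v))"

definition is_simple_or_smooth :: "('i, 'a::euclidean_space) presentation \<Rightarrow> bool" where
  "is_simple_or_smooth P \<longleftrightarrow>
     (case vlattice P of None \<Rightarrow> is_simple P | Some L \<Rightarrow> is_smooth P L)"

definition is_simplex :: "nat \<Rightarrow> ('i, 'a::euclidean_space) presentation \<Rightarrow> bool" where
  "is_simplex k P \<longleftrightarrow>
     is_simple_or_smooth P \<and> dim (vspace P) = k \<and> card (index P) = k + 1"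


(* The element of T that represents the linear functional \<phi> on T. *)

definition riesz :: "'a::euclidean_space set \<Rightarrow> ('a \<Rightarrow> real) \<Rightarrow> 'a" where
  "riesz T \<phi> = (THE w. w \<in> T \<and> (\<forall>x\<in>T. w \<bullet> x = \<phi> x))"

(* The map on the space T that is dual to the linear map f on the dual space of T. *)

definition dual_map :: "'a::euclidean_space set \<Rightarrow> ('a \<Rightarrow> 'a) \<Rightarrow> 'a \<Rightarrow> 'a" where
  "dual_map T f \<eta> = riesz T (\<lambda>x. \<eta> \<bullet> f x)"

(* Let U be the annihilator in the dual space of T of the span W of the conormals of the
   facets in J. The quotient T/W is the dual space of U and hence is represented by U; the class
   of v in T/W is represented by the restriction to U of the pairing with v. The base point p
   only serves to translate the affine span of the face to U. The facets of the face are its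
   nonempty intersections with further facets. *)

definition face_presentation ::
  "('i, 'a::euclidean_space) presentation \<Rightarrow> 'i set \<Rightarrow> ('i, 'a) presentation" where
  "face_presentation P J =
     (let U = {x \<in> vspace P. \<forall>j\<in>J. conormal P j \<bullet> x = 0};
          q = (\<lambda>v. riesz U (\<lambda>x. v \<bullet> x));
          p = (SOME p. p \<in> face P J)
      in \<lparr>vspace = U,
          vlattice = map_option (image q) (vlattice P),
          index = {i \<in> index P - J. face P (insert i J) \<noteq> {}},
          conormal = (\<lambda>i. q (conormal P i)),
          supp = (\<lambda>i. supp P i - conormal P i \<bullet> p)\<rparr>)"


(* Support numbers are functions on the whole index type, with the product topology. The
   values outside the index set are irrelevant: they contribute a connected factor to the chamber. *)

definition chamber :: "('i, 'a::euclidean_space) presentation \<Rightarrow> ('i \<Rightarrow> real) set" where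
  "chamber P = connected_component_set {\<kappa>. is_simple (P\<lparr>supp := \<kappa>\<rparr>)} (supp P)"

(* The affine map x \<mapsto> f x + c is a symmetry. That f is linear on the whole Euclidean
   space is no restriction: every linear map on a subspace extends. *)

definition is_symmetry ::
  "('i, 'a::euclidean_space) presentation \<Rightarrow> ('a \<Rightarrow> 'a) \<Rightarrow> 'a \<Rightarrow> bool" where
  "is_symmetry P f c \<longleftrightarrow>
     linear f \<and> f ` vspace P \<subseteq> vspace P \<and> c \<in> vspace P \<and>
     (\<lambda>x. f x + c) ` body P = body P \<and>
     (case vlattice P of None \<Rightarrow> True | Some L \<Rightarrow> dual_map (vspace P) f ` L = L)"

definition is_robust :: "('i, 'a::euclidean_space) presentation \<Rightarrow> ('a \<Rightarrow> 'a) \<Rightarrow> bool" where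
  "is_robust P f \<longleftrightarrow> (\<forall>\<kappa>\<in>chamber P. \<exists>c. is_symmetry (P\<lparr>supp := \<kappa>\<rparr>) f c)"

definition equivalent_facets ::
  "('i, 'a::euclidean_space) presentation \<Rightarrow> 'i \<Rightarrow> 'i \<Rightarrow> bool" where
  "equivalent_facets P i j \<longleftrightarrow>
     (\<exists>f. is_robust P f \<and>
        (\<forall>\<kappa>\<in>chamber P. \<forall>c. is_symmetry (P\<lparr>supp := \<kappa>\<rparr>) f c \<longrightarrow>
           (\<lambda>x. f x + c) ` facet (P\<lparr>supp := \<kappa>\<rparr>) i = facet (P\<lparr>supp := \<kappa>\<rparr>) j))"

definition facet_classes :: "('i, 'a::euclidean_space) presentation \<Rightarrow> 'i set set" where
  "facet_classes P =
     index P // {(i, j). i \<in> index P \<and> j \<in> index P \<and> equivalent_facets P i j}"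

(* Without a lattice, conormals are normalized compatibly with the robust symmetries; with a
   lattice they are primitive, which is part of the definition of is_smooth. *)

definition is_normalized :: "('i, 'a::euclidean_space) presentation \<Rightarrow> bool" where
  "is_normalized P \<longleftrightarrow>
     (vlattice P = None \<longrightarrow>
        (\<forall>f. is_robust P f \<longrightarrow>
           (\<forall>i\<in>index P. \<exists>j\<in>index P. dual_map (vspace P) f (conormal P i) = conormal P j)))"


(* Without a lattice, conormals are only defined up to positive multiples. *)

definition conormal_choices ::
  "('i, 'a::euclidean_space) presentation \<Rightarrow> ('i, 'a) presentation set" where
  "conormal_choices P =
     (case vlattice P of
        None \<Rightarrow> {P\<lparr>conormal := (\<lambda>i. r i *\<^sub>R conormal P i), supp := (\<lambda>i. r i * supp P i)\<rparr> | r.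
                   \<forall>i. r i > 0}
      | Some L \<Rightarrow> {P})"

definition product_presentation ::
  "('i, 'a::euclidean_space) presentation \<Rightarrow> ('j, 'b::euclidean_space) presentation \<Rightarrow>
   ('i + 'j, 'a \<times> 'b) presentation" where
  "product_presentation Q R =
     \<lparr>vspace = vspace Q \<times> vspace R,
      vlattice = (case (vlattice Q, vlattice R) of
                    (Some L, Some M) \<Rightarrow> Some (L \<times> M) | _ \<Rightarrow> None),
      index = index Q <+> index R,
      conormal = case_sum (\<lambda>j. (conormal Q j, 0)) (\<lambda>i. (0, conormal R i)),
      supp = case_sum (supp Q) (supp R)\<rparr>"

definition combinatorial_equivalence ::
  "('i, 'a::euclidean_space) presentation \<Rightarrow> ('j, 'b::euclidean_space) presentation \<Rightarrow>
   ('i \<Rightarrow> 'j) \<Rightarrow> bool" where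
  "combinatorial_equivalence P Q \<phi> \<longleftrightarrow>
     bij_betw \<phi> (index P) (index Q) \<and>
     (\<forall>J\<subseteq>index P. face P J \<noteq> {} \<longleftrightarrow> face Q (\<phi> ` J) \<noteq> {})"

definition short_exact ::
  "'b::euclidean_space set \<Rightarrow> 'a::euclidean_space set \<Rightarrow> 'c::euclidean_space set \<Rightarrow>
   ('b \<Rightarrow> 'a) \<Rightarrow> ('a \<Rightarrow> 'c) \<Rightarrow> bool" where
  "short_exact A B C \<iota> \<pi> \<longleftrightarrow>
     inj_on \<iota> A \<and> \<iota> ` A = {v \<in> B. \<pi> v = 0} \<and> \<pi> ` B = C"

(* P is a Q bundle over R for the recorded conormals; S is the set of base facets. *)

definition is_bundle_recorded ::
  "('i, 'a::euclidean_space) presentation \<Rightarrow> ('j, 'b::euclidean_space) presentation \<Rightarrow>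
   ('k, 'c::euclidean_space) presentation \<Rightarrow> 'i set \<Rightarrow> bool" where
  "is_bundle_recorded P Q R S \<longleftrightarrow>
     (\<exists>\<iota> \<pi> \<phi>. linear \<iota> \<and> linear \<pi> \<and>
        short_exact (vspace Q) (vspace P) (vspace R) \<iota> \<pi> \<and>
        (case (vlattice Q, vlattice P, vlattice R) of
           (None, None, None) \<Rightarrow> True
         | (Some LQ, Some LP, Some LR) \<Rightarrow> short_exact LQ LP LR \<iota> \<pi>
         | _ \<Rightarrow> False) \<and>
        combinatorial_equivalence (product_presentation Q R) P \<phi> \<and>
        (\<forall>j\<in>index Q. conormal P (\<phi> (Inl j)) = \<iota> (conormal Q j)) \<and>
        (\<forall>i\<in>index R. \<pi> (conormal P (\<phi> (Inr i))) = conormal R i) \<and>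
        S = (\<phi> \<circ> Inr) ` index R)"

definition is_bundle ::
  "('i, 'a::euclidean_space) presentation \<Rightarrow> ('j, 'b::euclidean_space) presentation \<Rightarrow>
   ('k, 'c::euclidean_space) presentation \<Rightarrow> 'i set \<Rightarrow> bool" where
  "is_bundle P Q R S \<longleftrightarrow>
     is_simple_or_smooth P \<and> is_simple_or_smooth Q \<and> is_simple_or_smooth R \<and>
     (\<exists>P'\<in>conormal_choices P. \<exists>Q'\<in>conormal_choices Q. \<exists>R'\<in>conormal_choices R.
        is_bundle_recorded P' Q' R' S)"

(* P is the k-fold expansion of Q along the facet f of Q, with base-type facets S, for the
   recorded conormals. The identification of vspace Q \<oplus> R^k with vspace P is given by \<iota> and the
   images e i of the standard basis vectors; as polytopes are considered up to affine
   isomorphism, body P may be translated. *)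

definition is_expansion_recorded ::
  "nat \<Rightarrow> ('i, 'a::euclidean_space) presentation \<Rightarrow>
   ('j, 'b::euclidean_space) presentation \<Rightarrow> 'j \<Rightarrow> 'i set \<Rightarrow> bool" where
  "is_expansion_recorded k P Q f S \<longleftrightarrow>
     (\<exists>\<iota> (e :: nat \<Rightarrow> 'a) p. linear \<iota> \<and> p \<in> vspace P \<and>
        (let \<theta> = (\<lambda>(v, s). \<iota> v + (\<Sum>i\<in>{1..k}. s i *\<^sub>R e i));
             \<eta> = (\<lambda>i. if i \<le> k then - e i else \<iota> (conormal Q f) + (\<Sum>i\<in>{1..k}. e i));
             \<kappa> = (\<lambda>i. if i \<le> k then 0 else supp Q f)
         in bij_betw \<theta> (vspace Q \<times> ({1..k} \<rightarrow>\<^sub>E (UNIV :: real set))) (vspace P) \<and>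
            (case (vlattice Q, vlattice P) of
               (None, None) \<Rightarrow> True
             | (Some LQ, Some LP) \<Rightarrow> \<theta> ` (LQ \<times> ({1..k} \<rightarrow>\<^sub>E (\<int> :: real set))) = LP
             | _ \<Rightarrow> False) \<and>
            (\<lambda>x. x - p) ` body P =
              {x \<in> vspace P.
                 (\<forall>j\<in>index Q - {f}. \<iota> (conormal Q j) \<bullet> x \<le> supp Q j) \<and>
                 (\<forall>i\<in>{1..k + 1}. \<eta> i \<bullet> x \<le> \<kappa> i)} \<and>
            S \<subseteq> index P \<and> conormal P ` S = \<eta> ` {1..k + 1}))"

definition is_expansion ::
  "nat \<Rightarrow> ('i, 'a::euclidean_space) presentation \<Rightarrow>
   ('j, 'b::euclidean_space) presentation \<Rightarrow> 'j \<Rightarrow> 'i set \<Rightarrow> bool" where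
  "is_expansion k P Q f S \<longleftrightarrow>
     is_simple_or_smooth P \<and> is_simple_or_smooth Q \<and> f \<in> index Q \<and>
     (\<exists>P'\<in>conormal_choices P. \<exists>Q'\<in>conormal_choices Q. is_expansion_recorded k P' Q' f S)"

end

theory Submission
  imports Defs
begin

text \<open>
  Write \<open>T\<close> for the space, \<open>\<eta>\<^sub>i\<close> for the conormals and \<open>\<kappa>\<^sub>i\<close> for the support numbers, and let
  \<open>I' = I - {n}\<close>. The whole argument rests on vectors that separate equivalent facets: for distinct
  \<open>i, j\<close> in one class there is \<open>\<xi>\<close> in the dual of \<open>T\<close> with \<open>\<langle>\<eta>\<^sub>i,\<xi>\<rangle> = 1\<close>, \<open>\<langle>\<eta>\<^sub>j,\<xi>\<rangle> = -1\<close> and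
  \<open>\<langle>\<eta>\<^sub>m,\<xi>\<rangle> = 0\<close> for all other \<open>m\<close> (\<open>equivalent_facets_separating_vector\<close>). To find it, take a robust
  symmetry with linear part \<open>f\<close> that carries \<open>F\<^sub>i\<close> to \<open>F\<^sub>j\<close>. The dual of \<open>f\<close> permutes the conormals, say
  \<open>f\<^sup>* \<eta>\<^sub>m = \<eta>\<^bsub>\<tau> m\<^esub>\<close> with \<open>\<tau> j = i\<close>. If \<open>x \<mapsto> f x + c\<close> preserves the polytope with support
  numbers \<open>\<kappa>\<close>, then \<open>\<kappa>\<^sub>m - \<kappa>\<^bsub>\<tau> m\<^esub> = \<langle>\<eta>\<^sub>m,c\<rangle>\<close>. Compare this identity for \<open>\<kappa>\<close> and for \<open>\<kappa>\<close> with
  \<open>\<kappa>\<^sub>i\<close> increased by a small \<open>t > 0\<close>: the difference of the two translation vectors, divided by \<open>t\<close>, is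
  \<open>\<xi>\<close>. The perturbed support numbers lie in the chamber because a simple polytope stays simple
  when its facets are moved slightly (\<open>simple_perturb\<close>).

  Thus there are \<open>\<xi>\<^sub>j\<close>, \<open>j \<in> I'\<close>, with \<open>\<langle>\<eta>\<^sub>i,\<xi>\<^sub>j\<rangle> = \<delta>\<^sub>i\<^sub>j\<close> for \<open>i \<in> I'\<close>, with \<open>\<langle>\<eta>\<^sub>n,\<xi>\<^sub>j\<rangle> = -1\<close>, and with
  \<open>\<langle>\<eta>\<^sub>m,\<xi>\<^sub>j\<rangle> = 0\<close> for \<open>m \<notin> I\<close>. They split \<open>T\<close> as the sum of the common kernel of the \<open>\<xi>\<^sub>j\<close>, which is a
  complement of the span of \<open>(\<eta>\<^sub>j)\<close>, \<open>j \<in> I'\<close>, and this span; in the smooth case the lattice splits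
  as well, because every \<open>\<xi>\<^sub>j\<close> is integral on all conormals. The first summand is isomorphic
  to the quotient of \<open>T\<close> by the second, which is the space of \<open>F\<^bsub>I'\<^esub>\<close>. The first summand contains
  \<open>\<eta>\<^sub>m\<close> for \<open>m \<notin> I\<close>, and the component of \<open>\<eta>\<^sub>n\<close> in it is \<open>\<eta>\<^sub>n + \<Sum>\<^sub>j \<eta>\<^sub>j\<close>; the component of
  \<open>\<eta>\<^sub>n\<close> in the second is \<open>-\<Sum>\<^sub>j \<eta>\<^sub>j\<close>. Moving a point of the polytope along the \<open>\<xi>\<^sub>j\<close> until it
  satisfies \<open>\<eta>\<^sub>j = \<kappa>\<^sub>j\<close> changes no \<open>\<eta>\<^sub>m\<close> with \<open>m \<notin> I\<close> and does not increase \<open>\<eta>\<^sub>n\<close>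
  (\<open>shift_into_face\<close>). Hence every facet outside \<open>I\<close> meets \<open>F\<^bsub>I'\<^esub>\<close>, so that the
  facets of \<open>F\<^bsub>I'\<^esub>\<close> are those outside \<open>I\<close> and, if \<open>F\<^sub>I\<close> is nonempty, also the one cut out
  by \<open>F\<^sub>n\<close>. If \<open>F\<^sub>I\<close> is nonempty, this is literally the description of an expansion, with
  \<open>e\<^sub>j = -\<eta>\<^sub>j\<close>. If \<open>F\<^sub>I\<close> is empty, the two projections form the exact sequence of a bundle whose base
  is the simplex with conormals \<open>\<eta>\<^sub>j\<close> and \<open>-\<Sum>\<^sub>j \<eta>\<^sub>j\<close>; the same motion along the \<open>\<xi>\<^sub>j\<close> shows that
  the faces of the polytope are those of the product (\<open>faces_of_bundle\<close>).
\<close>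

section \<open>Functionals on a subspace\<close>

lemma riesz_eqI:
  assumes "subspace U" "w \<in> U" "\<And>x. x \<in> U \<Longrightarrow> w \<bullet> x = \<phi> x"
  shows "riesz U \<phi> = w"
  unfolding riesz_def
proof (rule the_equality)
  fix w' assume w': "w' \<in> U \<and> (\<forall>x\<in>U. w' \<bullet> x = \<phi> x)"
  have "w' - w \<in> U" using w' assms subspace_diff by blast
  then have "(w' - w) \<bullet> (w' - w) = 0"
    using w' assms(3) by (metis inner_diff_left right_minus_eq)
  then show "w' = w" by simp
qed (use assms in auto)

lemma riesz_inner:
  fixes U :: "'a::euclidean_space set"
  assumes "subspace U"
  shows "riesz U (\<lambda>x. v \<bullet> x) \<in> U" and "x \<in> U \<Longrightarrow> riesz U (\<lambda>x. v \<bullet> x) \<bullet> x = v \<bullet> x"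
proof -
  obtain y z where yz: "y \<in> span U" "\<And>w. w \<in> span U \<Longrightarrow> orthogonal z w" "v = y + z"
    using orthogonal_subspace_decomp_exists[of U v] by blast
  have sp: "span U = U" using assms by (simp add: span_eq_iff)
  have "riesz U (\<lambda>x. v \<bullet> x) = y"
    using yz sp by (intro riesz_eqI assms) (auto simp: orthogonal_def inner_add_left)
  then show "riesz U (\<lambda>x. v \<bullet> x) \<in> U" "x \<in> U \<Longrightarrow> riesz U (\<lambda>x. v \<bullet> x) \<bullet> x = v \<bullet> x"
    using yz sp by (auto simp: orthogonal_def inner_add_left)
qed

lemma riesz_inner_id: "subspace U \<Longrightarrow> v \<in> U \<Longrightarrow> riesz U (\<lambda>x. v \<bullet> x) = v"
  by (rule riesz_eqI) auto

lemma linear_riesz_inner: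
  fixes U :: "'a::euclidean_space set"
  assumes "subspace U"
  shows "linear (\<lambda>v. riesz U (\<lambda>x. v \<bullet> x))"
proof (rule linearI)
  fix v w :: 'a and r :: real
  show "riesz U (\<lambda>x. (v + w) \<bullet> x) = riesz U (\<lambda>x. v \<bullet> x) + riesz U (\<lambda>x. w \<bullet> x)"
    by (rule riesz_eqI) (auto simp: assms riesz_inner subspace_add inner_add_left)
  show "riesz U (\<lambda>x. (r *\<^sub>R v) \<bullet> x) = r *\<^sub>R riesz U (\<lambda>x. v \<bullet> x)"
    by (rule riesz_eqI) (auto simp: assms riesz_inner subspace_scale)
qed

lemma dual_map_props:
  assumes "subspace T" "linear f"
  shows "dual_map T f \<eta> \<in> T" and "x \<in> T \<Longrightarrow> dual_map T f \<eta> \<bullet> x = \<eta> \<bullet> f x"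
proof -
  have "(\<lambda>x. \<eta> \<bullet> f x) = (\<lambda>x. adjoint f \<eta> \<bullet> x)"
    using adjoint_works[OF assms(2)] by (metis inner_commute)
  then have "dual_map T f \<eta> = riesz T (\<lambda>x. adjoint f \<eta> \<bullet> x)" by (simp add: dual_map_def)
  then show "dual_map T f \<eta> \<in> T" "x \<in> T \<Longrightarrow> dual_map T f \<eta> \<bullet> x = \<eta> \<bullet> f x"
    using riesz_inner(1)[OF assms(1), where v="adjoint f \<eta>"]
      riesz_inner(2)[OF assms(1), where v="adjoint f \<eta>" and x=x] adjoint_works[OF assms(2), of x \<eta>]
    by (simp_all add: inner_commute[of "f x"] inner_commute[of x])
qed

lemma subspace_inner_eqI:
  fixes v w :: "'a::euclidean_space"
  assumes "subspace T" "v \<in> T" "w \<in> T" "\<And>x. x \<in> T \<Longrightarrow> v \<bullet> x = w \<bullet> x"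
  shows "v = w"
  using riesz_eqI[of T v "\<lambda>x. w \<bullet> x"] riesz_inner_id[of T w] assms by metis

lemma subspace_inner_zeroI:
  "subspace T \<Longrightarrow> v \<in> T \<Longrightarrow> (\<And>x. x \<in> T \<Longrightarrow> v \<bullet> x = 0) \<Longrightarrow> v = (0::'a::euclidean_space)"
  by (metis inner_eq_zero_iff)

lemma spanning_inner_zeroI:
  assumes "span B = T" "v \<in> T" "\<And>b. b \<in> B \<Longrightarrow> b \<bullet> v = 0"
  shows "v = (0::'a::euclidean_space)"
proof -
  have "orthogonal v v" using orthogonal_to_span[of v B v] assms
    by (auto simp: orthogonal_def inner_commute)
  then show ?thesis by (simp add: orthogonal_def)
qed

lemma inner_kernel_imp_multiple:
  fixes v w :: "'a::euclidean_space"
  assumes "subspace T" "v \<in> T" "w \<in> T" "w \<noteq> 0" "\<And>u. u \<in> T \<Longrightarrow> w \<bullet> u = 0 \<Longrightarrow> v \<bullet> u = 0"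
  obtains r where "v = r *\<^sub>R w"
proof -
  define r where "r = (v \<bullet> w) / (w \<bullet> w)"
  define u where "u = v - r *\<^sub>R w"
  have "u \<in> T" using assms by (simp add: u_def subspace_diff subspace_scale)
  moreover have w: "w \<bullet> u = 0" using assms(4) by (simp add: u_def r_def inner_diff_right inner_commute)
  ultimately have "v \<bullet> u = 0" using assms(5) by blast
  then have "u \<bullet> u = 0" using w by (simp add: u_def inner_diff_left inner_commute)
  then show ?thesis using that[of r] by (simp add: u_def)
qed

section \<open>Polytopes with irredundant inequalities\<close>

text \<open>If each of finitely many inequalities that hold on a convex set is strict somewhere on it,
  then all of them are strict at a common point.\<close>

lemma strict_common_point:
  fixes h :: "'i \<Rightarrow> 'a::euclidean_space"
  assumes "finite A" "convex S" "S \<noteq> {}"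
    and "\<And>i x. i \<in> A \<Longrightarrow> x \<in> S \<Longrightarrow> h i \<bullet> x \<le> k i"
    and "\<And>i. i \<in> A \<Longrightarrow> \<exists>x\<in>S. h i \<bullet> x \<noteq> k i"
  shows "\<exists>x\<in>S. \<forall>i\<in>A. h i \<bullet> x < k i"
  using assms(1,4,5)
proof (induction A rule: finite_induct)
  case empty
  then show ?case using assms(3) by auto
next
  case (insert a A)
  obtain x where x: "x \<in> S" "\<forall>i\<in>A. h i \<bullet> x < k i" using insert by auto
  obtain y where y: "y \<in> S" "h a \<bullet> y \<noteq> k a" using insert.prems(2)[of a] by auto
  have mid: "(1/2) *\<^sub>R x + (1/2) *\<^sub>R y \<in> S"
    using assms(2) x y by (simp add: convexD)
  have "h i \<bullet> ((1/2) *\<^sub>R x + (1/2) *\<^sub>R y) < k i" if "i \<in> insert a A" for i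
  proof -
    have le: "h i \<bullet> x \<le> k i" "h i \<bullet> y \<le> k i" using insert.prems(1) that x y by auto
    have "h i \<bullet> x < k i \<or> h i \<bullet> y < k i"
      using that x y insert.prems(1)[of a y] by fastforce
    then show ?thesis using le by (auto simp: inner_add_right)
  qed
  then show ?case using mid by blast
qed

lemma body_iff: "x \<in> body P \<longleftrightarrow> x \<in> vspace P \<and> (\<forall>i\<in>index P. conormal P i \<bullet> x \<le> supp P i)"
  by (simp add: body_def)

lemma facet_iff: "x \<in> facet P i \<longleftrightarrow> x \<in> body P \<and> conormal P i \<bullet> x = supp P i"
  by (simp add: facet_def)

lemma face_iff: "x \<in> face P J \<longleftrightarrow> x \<in> body P \<and> (\<forall>j\<in>J. conormal P j \<bullet> x = supp P j)"
  by (auto simp: face_def facet_def)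

lemma facets_at_iff:
  "x \<in> body P \<Longrightarrow> i \<in> facets_at P x \<longleftrightarrow> i \<in> index P \<and> conormal P i \<bullet> x = supp P i"
  by (simp add: facets_at_def facet_def)

lemma body_as_Int:
  "body P = vspace P \<inter> (\<Inter>i\<in>index P. {x. conormal P i \<bullet> x \<le> supp P i})"
  by (auto simp: body_def)

lemma convex_body: "subspace (vspace P) \<Longrightarrow> convex (body P)"
  unfolding body_as_Int
  by (intro convex_Int convex_INT convex_halfspace_le) (auto intro: subspace_imp_convex)

lemma closed_body:
  assumes "subspace (vspace P)"
  shows "closed (body P)"
proof -
  have "closed (\<Inter>i\<in>index P. {x. conormal P i \<bullet> x \<le> supp P i})"
    by (intro closed_INT ballI closed_halfspace_le)
  then show ?thesis
    unfolding body_as_Int by (rule closed_Int[OF closed_subspace[OF assms]])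
qed

lemma convex_face: "subspace (vspace P) \<Longrightarrow> convex (face P J)"
  unfolding face_def facet_def
  by (intro convex_Int convex_INT convex_body) (auto simp: convex_hyperplane convex_body)

lemma closed_face: "subspace (vspace P) \<Longrightarrow> closed (face P J)"
  unfolding face_def facet_def
  by (intro closed_Int closed_INT closed_body) (auto simp: closed_hyperplane closed_body closed_Int)

lemma face_singleton: "face P {i} = facet P i"
  by (auto simp: face_def facet_def)

lemma face_face_of:
  assumes "subspace (vspace P)" "J \<subseteq> index P"
  shows "face P J face_of body P"
proof -
  have "facet P j face_of body P" if "j \<in> index P" for j
    unfolding facet_def
    by (rule face_of_Int_supporting_hyperplane_le[OF convex_body[OF assms(1)]])
      (use that in \<open>simp add: body_iff\<close>)
  then have "\<Inter> (insert (body P) (facet P ` J)) face_of body P"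
    by (intro face_of_Inter) (use assms face_of_refl[OF convex_body] in auto)
  then show ?thesis by (simp add: face_def)
qed

text \<open>The hull conditions in the definition of a polytope can be replaced by the existence of points at
  which prescribed inequalities are strict: this lemma and the next one obtain them, and
  \<open>is_polytopeI\<close> is the converse. The strict points are stable under small changes and are easy to
  exhibit for faces and simplices.\<close>

lemma polytope_interior_point:
  assumes "is_polytope P"
  obtains x where "x \<in> vspace P" "\<And>i. i \<in> index P \<Longrightarrow> conormal P i \<bullet> x < supp P i"
proof -
  have T: "subspace (vspace P)" "finite (index P)" "affine hull (body P) = vspace P"
    using assms by (auto simp: is_polytope_def)
  have ne: "body P \<noteq> {}" using T(1,3) subspace_0 by force
  have "\<exists>x\<in>body P. conormal P i \<bullet> x \<noteq> supp P i" if i: "i \<in> index P" for i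
  proof (rule ccontr)
    assume "\<not> ?thesis"
    then have "affine hull (body P) \<subseteq> {x. conormal P i \<bullet> x = supp P i}"
      by (intro hull_minimal affine_hyperplane) auto
    moreover have "0 \<in> vspace P" "conormal P i \<in> vspace P" "conormal P i \<noteq> 0"
      using assms i T(1) by (auto simp: is_polytope_def subspace_0)
    ultimately have "conormal P i \<bullet> 0 = supp P i" "conormal P i \<bullet> conormal P i = supp P i"
      unfolding T(3) by blast+
    then show False using \<open>conormal P i \<noteq> 0\<close> by simp
  qed
  then have "\<exists>x\<in>body P. \<forall>i\<in>index P. conormal P i \<bullet> x < supp P i"
    by (intro strict_common_point T ne convex_body) (auto simp: body_iff)
  then show ?thesis using that by (auto simp: body_iff)
qed

lemma polytope_facet_point:
  assumes "is_polytope P" "i \<in> index P"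
  obtains x where "x \<in> vspace P" "conormal P i \<bullet> x = supp P i"
    "\<And>j. j \<in> index P \<Longrightarrow> j \<noteq> i \<Longrightarrow> conormal P j \<bullet> x < supp P j"
proof -
  have T: "subspace (vspace P)" "finite (index P)"
    and hull: "\<And>j. j \<in> index P \<Longrightarrow>
      affine hull (facet P j) = {x \<in> vspace P. conormal P j \<bullet> x = supp P j}"
    and con: "\<And>j. j \<in> index P \<Longrightarrow> conormal P j \<in> vspace P \<and> conormal P j \<noteq> 0"
    and inj: "inj_on (facet P) (index P)"
    using assms by (auto simp: is_polytope_def)
  have "(supp P i / (conormal P i \<bullet> conormal P i)) *\<^sub>R conormal P i \<in> affine hull (facet P i)"
    using con[OF assms(2)] T(1) by (simp add: hull[OF assms(2)] subspace_scale)
  then have ne: "facet P i \<noteq> {}" by auto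
  \<comment> \<open>Otherwise the hyperplanes of both facets coincide, and then so do the facets.\<close>
  have "\<exists>x\<in>facet P i. conormal P j \<bullet> x \<noteq> supp P j" if j: "j \<in> index P - {i}" for j
  proof (rule ccontr)
    assume "\<not> ?thesis"
    then have all: "\<And>x. x \<in> facet P i \<Longrightarrow> conormal P j \<bullet> x = supp P j" by blast
    then have "affine hull (facet P i) \<subseteq> {x. conormal P j \<bullet> x = supp P j}"
      by (intro hull_minimal affine_hyperplane) auto
    then have H: "conormal P j \<bullet> x = supp P j" if "x \<in> vspace P" "conormal P i \<bullet> x = supp P i" for x
      using hull[OF assms(2)] that by auto
    obtain x0 where x0: "x0 \<in> facet P i" using ne by blast
    have x0': "x0 \<in> vspace P" "conormal P i \<bullet> x0 = supp P i" "conormal P j \<bullet> x0 = supp P j"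
      using x0 all by (auto simp: facet_iff body_iff)
    obtain r where r: "conormal P j = r *\<^sub>R conormal P i"
    proof (rule inner_kernel_imp_multiple[OF T(1), of "conormal P j" "conormal P i"])
      fix u assume u: "u \<in> vspace P" "conormal P i \<bullet> u = 0"
      have "conormal P j \<bullet> (x0 + u) = supp P j"
        by (rule H) (use u x0' T(1) in \<open>auto simp: subspace_add inner_add_right\<close>)
      then show "conormal P j \<bullet> u = 0" using x0' by (simp add: inner_add_right)
    qed (use con j assms(2) in auto)
    have "r \<noteq> 0" using r con j by auto
    moreover have "supp P j = r * supp P i" using x0' r by auto
    ultimately have "facet P i = facet P j" by (auto simp: facet_def r)
    then show False using inj j assms(2) by (auto simp: inj_on_def)
  qed
  then have "\<exists>x\<in>facet P i. \<forall>j\<in>index P - {i}. conormal P j \<bullet> x < supp P j"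
    by (intro strict_common_point ne)
      (use T convex_face[of P "{i}"] in \<open>auto simp: facet_iff body_iff face_singleton\<close>)
  then show ?thesis using that by (auto simp: facet_iff body_iff)
qed

lemma polytope_facet_nonempty:
  assumes P: "is_polytope P" and i: "i \<in> index P"
  shows "facet P i \<noteq> {}"
proof -
  obtain y where "y \<in> vspace P" "conormal P i \<bullet> y = supp P i"
      "\<And>j. j \<in> index P \<Longrightarrow> j \<noteq> i \<Longrightarrow> conormal P j \<bullet> y < supp P j"
    by (rule polytope_facet_point[OF P i]) blast
  then have "y \<in> facet P i" unfolding facet_iff body_iff by (metis less_eq_real_def)
  then show ?thesis by blast
qed

lemma is_polytopeI:
  fixes P :: "('i, 'a::euclidean_space) presentation"
  assumes T: "subspace (vspace P)" and fin: "finite (index P)" and "bounded (body P)"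
    and con: "\<And>i. i \<in> index P \<Longrightarrow> conormal P i \<in> vspace P \<and> conormal P i \<noteq> 0"
    and inner: "\<exists>x\<in>vspace P. \<forall>i\<in>index P. conormal P i \<bullet> x < supp P i"
    and fac: "\<And>i. i \<in> index P \<Longrightarrow> \<exists>x\<in>vspace P. conormal P i \<bullet> x = supp P i \<and>
        (\<forall>j\<in>index P - {i}. conormal P j \<bullet> x < supp P j)"
  shows "is_polytope P"
proof -
  let ?T = "vspace P"
  have op: "open (\<Inter>j\<in>J. {x. conormal P j \<bullet> x < supp P j})" if "J \<subseteq> index P" for J
    using fin that finite_subset by (intro open_INT) (auto simp: open_halfspace_lt)
  have hull: "affine hull B = H"
    if "affine H" "J \<subseteq> index P" "x \<in> H" "\<forall>j\<in>J. conormal P j \<bullet> x < supp P j" "B \<subseteq> H"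
      "\<And>x. x \<in> H \<Longrightarrow> \<forall>j\<in>J. conormal P j \<bullet> x < supp P j \<Longrightarrow> x \<in> B" for B H J x
  proof -
    let ?S = "H \<inter> (\<Inter>j\<in>J. {x. conormal P j \<bullet> x < supp P j})"
    have H: "affine hull H = H" using that by (simp add: affine_hull_eq)
    have "affine hull ?S = affine hull H"
      by (rule affine_hull_openin) (use op[OF that(2)] that(3,4) in \<open>auto simp: H openin_open_Int\<close>)
    moreover have "?S \<subseteq> B" using that by auto
    then have "affine hull ?S \<subseteq> affine hull B" by (rule hull_mono)
    moreover have "affine hull B \<subseteq> H" by (rule hull_minimal) (use that in auto)
    ultimately show ?thesis using H by auto
  qed
  obtain x where x: "x \<in> ?T" "\<forall>i\<in>index P. conormal P i \<bullet> x < supp P i" using inner by blast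
  have "affine hull (body P) = ?T"
    by (rule hull[OF subspace_imp_affine[OF T] subset_refl x])
      (auto simp: body_iff less_eq_real_def)
  moreover have "affine hull (facet P i) = {x \<in> ?T. conormal P i \<bullet> x = supp P i}"
    if i: "i \<in> index P" for i
  proof -
    obtain y where y: "y \<in> ?T" "conormal P i \<bullet> y = supp P i"
        "\<forall>j\<in>index P - {i}. conormal P j \<bullet> y < supp P j" using fac[OF i] by blast
    have "affine {x \<in> ?T. conormal P i \<bullet> x = supp P i}"
      using affine_Int[OF subspace_imp_affine[OF T] affine_hyperplane[of "conormal P i" "supp P i"]]
      by (simp add: Int_def)
    then show ?thesis
      by (rule hull[where J="index P - {i}" and x=y])
        (use y in \<open>auto simp: facet_iff body_iff less_eq_real_def\<close>)
  qed
  moreover have "inj_on (facet P) (index P)"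
  proof (rule inj_onI, rule ccontr)
    fix i j assume ij: "i \<in> index P" "j \<in> index P" "facet P i = facet P j" "i \<noteq> j"
    obtain y where y: "y \<in> ?T" "conormal P i \<bullet> y = supp P i"
        "\<forall>j\<in>index P - {i}. conormal P j \<bullet> y < supp P j" using fac[OF ij(1)] by blast
    have "conormal P l \<bullet> y \<le> supp P l" if "l \<in> index P" for l
      using y(2,3) that by (cases "l = i") (auto simp: less_eq_real_def)
    then have "y \<in> facet P i" using y by (simp add: facet_iff body_iff)
    then have "conormal P j \<bullet> y = supp P j" using ij by (simp add: facet_iff)
    then show False using y ij by force
  qed
  ultimately show ?thesis using assms by (simp add: is_polytope_def)
qed

section \<open>Vertices\<close>

lemma interior_slack:
  fixes P :: "('i, 'a::euclidean_space) presentation"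
  assumes "finite A" "\<And>i. i \<in> A \<Longrightarrow> conormal P i \<bullet> x < supp P i"
  shows "\<exists>e>0. \<forall>i\<in>A. \<forall>s. \<bar>s\<bar> \<le> e \<longrightarrow> conormal P i \<bullet> (x + s *\<^sub>R u) < supp P i"
proof -
  have "\<forall>\<^sub>F s in nhds (0::real). \<forall>i\<in>A. conormal P i \<bullet> (x + s *\<^sub>R u) < supp P i"
  proof (intro eventually_ball_finite ballI assms(1))
    fix i assume "i \<in> A"
    have "((\<lambda>s. conormal P i \<bullet> (x + s *\<^sub>R u)) \<longlongrightarrow> conormal P i \<bullet> (x + 0 *\<^sub>R u)) (nhds (0::real))"
      by (intro tendsto_intros filterlim_ident)
    then show "\<forall>\<^sub>F s in nhds (0::real). conormal P i \<bullet> (x + s *\<^sub>R u) < supp P i"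
      using assms(2)[OF \<open>i \<in> A\<close>] order_tendstoD(2) by fastforce
  qed
  then obtain d where "d > 0" "\<And>s. \<bar>s\<bar> < d \<Longrightarrow> \<forall>i\<in>A. conormal P i \<bullet> (x + s *\<^sub>R u) < supp P i"
    by (auto simp: eventually_nhds_metric)
  then show ?thesis by (intro exI[of _ "d/2"]) auto
qed

lemma interior_step:
  fixes P :: "('i, 'a::euclidean_space) presentation"
  assumes "finite A" "\<And>i. i \<in> A \<Longrightarrow> conormal P i \<bullet> x < supp P i"
  obtains e where "e > 0" "\<And>i. i \<in> A \<Longrightarrow> conormal P i \<bullet> (x + e *\<^sub>R u) < supp P i"
  using interior_slack[OF assms, of u] by (metis abs_of_pos order_refl)

text \<open>Otherwise a nonzero vector orthogonal to all active conormals would give a segment in the body with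
  the vertex as its midpoint.\<close>

lemma extreme_point_span:
  fixes P :: "('i, 'a::euclidean_space) presentation"
  assumes T: "subspace (vspace P)" and fin: "finite (index P)"
    and con: "\<And>i. i \<in> index P \<Longrightarrow> conormal P i \<in> vspace P"
    and v: "v extreme_point_of body P"
  shows "span (conormal P ` facets_at P v) = vspace P"
proof -
  let ?A = "facets_at P v" and ?T = "vspace P"
  have vb: "v \<in> body P" using v by (simp add: extreme_point_of_def)
  note at = facets_at_iff[OF vb]
  have sub: "span (conormal P ` ?A) \<subseteq> ?T"
    by (rule span_minimal) (use at con T in auto)
  have "?T \<subseteq> span (conormal P ` ?A)"
  proof (rule ccontr)
    assume "\<not> ?thesis"
    then have "span (conormal P ` ?A) \<subset> span ?T"
      using sub T by (metis psubsetI span_eq_iff subset_refl)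
    then obtain u where u: "u \<noteq> 0" "u \<in> span ?T" "\<And>y. y \<in> span (conormal P ` ?A) \<Longrightarrow> orthogonal u y"
      using orthogonal_to_subspace_exists_gen by metis
    have uT: "u \<in> ?T" using u(2) T by (metis span_eq_iff)
    have u0: "conormal P i \<bullet> u = 0" if "i \<in> ?A" for i
      using u(3)[of "conormal P i"] that by (simp add: span_base orthogonal_def inner_commute)
    have "conormal P i \<bullet> v < supp P i" if "i \<in> index P - ?A" for i
      using that at vb by (auto simp: body_iff less_le)
    then obtain e where e: "e > 0"
        "\<And>i s. i \<in> index P - ?A \<Longrightarrow> \<bar>s\<bar> \<le> e \<Longrightarrow> conormal P i \<bullet> (v + s *\<^sub>R u) < supp P i"
      using interior_slack[of "index P - ?A" P v u] fin by blast
    have inb: "v + s *\<^sub>R u \<in> body P" if "\<bar>s\<bar> \<le> e" for s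
    proof -
      have "conormal P i \<bullet> (v + s *\<^sub>R u) \<le> supp P i" if i: "i \<in> index P" for i
      proof (cases "i \<in> ?A")
        case True
        then show ?thesis using u0 at by (simp add: inner_add_right)
      qed (use e(2)[of i s] i \<open>\<bar>s\<bar> \<le> e\<close> in auto)
      then show ?thesis using vb uT T by (simp add: body_iff subspace_add subspace_scale)
    qed
    have "v \<in> open_segment (v + e *\<^sub>R u) (v + (-e) *\<^sub>R u)"
    proof -
      have "midpoint (v + e *\<^sub>R u) (v + (-e) *\<^sub>R u) = v"
        by (simp add: midpoint_def scaleR_2[symmetric])
      moreover have "v + e *\<^sub>R u \<noteq> v + (-e) *\<^sub>R u"
      proof
        assume "v + e *\<^sub>R u = v + (-e) *\<^sub>R u"
        then have "e *\<^sub>R u = - (e *\<^sub>R u)" by simp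
        then have "2 *\<^sub>R (e *\<^sub>R u) = 0" by (metis scaleR_2 add.right_inverse)
        then show False using u(1) e(1) by simp
      qed
      ultimately show ?thesis by (metis midpoint_in_open_segment)
    qed
    then show False using v inb[of e] inb[of "-e"] e(1) by (auto simp: extreme_point_of_def)
  qed
  then show ?thesis using sub by blast
qed

lemma extreme_pointI:
  fixes P :: "('i, 'a::euclidean_space) presentation"
  assumes T: "subspace (vspace P)" and v: "v \<in> body P"
    and B: "span (conormal P ` B) = vspace P" "B \<subseteq> facets_at P v"
  shows "v extreme_point_of body P"
proof -
  have "\<not> (a \<in> body P \<and> b \<in> body P \<and> v \<in> open_segment a b)" for a b
  proof
    assume ab: "a \<in> body P \<and> b \<in> body P \<and> v \<in> open_segment a b"
    then obtain t where t: "a \<noteq> b" "0 < t" "t < 1" "v = (1 - t) *\<^sub>R a + t *\<^sub>R b"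
      by (auto simp: in_segment)
    have "conormal P i \<bullet> (a - b) = 0" if "i \<in> B" for i
    proof -
      have i: "i \<in> index P" "conormal P i \<bullet> v = supp P i"
        using that B facets_at_iff[OF v] by auto
      then have le: "conormal P i \<bullet> a \<le> supp P i" "conormal P i \<bullet> b \<le> supp P i"
        using ab by (auto simp: body_iff)
      have "(1 - t) * (supp P i - conormal P i \<bullet> a) + t * (supp P i - conormal P i \<bullet> b) = 0"
        using i(2) by (simp add: t(4) inner_add_right algebra_simps)
      then have "(1 - t) * (supp P i - conormal P i \<bullet> a) = 0" "t * (supp P i - conormal P i \<bullet> b) = 0"
        using le t by (smt (verit) mult_nonneg_nonneg)+
      then show ?thesis using t by (simp add: inner_diff_right)
    qed
    then have "a - b = 0"
      by (intro spanning_inner_zeroI[OF B(1)]) (use ab T in \<open>auto simp: body_iff subspace_diff\<close>)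
    then show False using t by simp
  qed
  then show ?thesis using v by (auto simp: extreme_point_of_def)
qed

text \<open>Along a basis, a system of linear equations has a solution in the spanned space.\<close>

lemma basis_solve:
  fixes h :: "'i \<Rightarrow> 'a::euclidean_space"
  assumes "inj_on h B" "independent (h ` B)" "span (h ` B) = T"
  obtains x where "x \<in> T" "\<And>i. i \<in> B \<Longrightarrow> h i \<bullet> x = c i"
proof -
  obtain g where g: "linear g" "\<And>x. x \<in> h ` B \<Longrightarrow> g x = c (the_inv_into B h x)"
    using linear_independent_extend[OF assms(2), of "\<lambda>x. c (the_inv_into B h x)"] by auto
  have T: "subspace T" using assms(3) subspace_span by blast
  define w where "w = adjoint g 1"
  have w: "w \<bullet> x = g x" for x
  proof -
    have "w \<bullet> x = g x \<bullet> 1"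
      unfolding w_def inner_commute[of _ x] by (rule adjoint_works[OF g(1)])
    then show ?thesis by simp
  qed
  let ?x = "riesz T (\<lambda>x. w \<bullet> x)"
  have "h i \<bullet> ?x = c i" if "i \<in> B" for i
  proof -
    have "h i \<in> T" using that span_base[of "h i" "h ` B"] assms(3) by simp
    then have "?x \<bullet> h i = w \<bullet> h i" by (rule riesz_inner(2)[OF T])
    also have "\<dots> = g (h i)" by (rule w)
    also have "\<dots> = c i" using g(2) that by (simp add: the_inv_into_f_f[OF assms(1)])
    finally show ?thesis by (simp add: inner_commute)
  qed
  then show ?thesis using that riesz_inner(1)[OF T] by blast
qed

lemma simple_vertex_basis:
  fixes P :: "('i, 'a::euclidean_space) presentation"
  assumes P: "is_simple P" and v: "v extreme_point_of body P"
  shows "inj_on (conormal P) (facets_at P v)" "independent (conormal P ` facets_at P v)"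
    "span (conormal P ` facets_at P v) = vspace P"
    "card (facets_at P v) = dim (vspace P)" "finite (facets_at P v)"
proof -
  let ?A = "facets_at P v"
  have pol: "is_polytope P" using P by (simp add: is_simple_def)
  show fin: "finite ?A"
    using pol by (simp add: facets_at_def is_polytope_def)
  show sp: "span (conormal P ` ?A) = vspace P"
    by (rule extreme_point_span) (use pol v in \<open>auto simp: is_polytope_def\<close>)
  show c: "card ?A = dim (vspace P)" using P v by (simp add: is_simple_def)
  have "dim (vspace P) \<le> card (conormal P ` ?A)"
    using dim_le_card[of "vspace P" "conormal P ` ?A"] sp fin by simp
  moreover have "card (conormal P ` ?A) \<le> card ?A" by (rule card_image_le[OF fin])
  ultimately have c': "card (conormal P ` ?A) = card ?A" using c by simp
  then show "inj_on (conormal P) ?A" by (rule eq_card_imp_inj_on[OF fin])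
  show "independent (conormal P ` ?A)"
    using card_le_dim_spanning[of "conormal P ` ?A" "vspace P"] sp fin c c'
    by (metis dim_span card_le_dim_spanning finite_imageI order_refl span_superset)
qed

lemma nonempty_face_vertex:
  fixes P :: "('i, 'a::euclidean_space) presentation"
  assumes P: "is_polytope P" and J: "J \<subseteq> index P" and ne: "face P J \<noteq> {}"
  obtains v where "v extreme_point_of body P" "v \<in> face P J" "J \<subseteq> facets_at P v"
proof -
  have T: "subspace (vspace P)" "bounded (body P)" using P by (auto simp: is_polytope_def)
  have "face P J \<subseteq> body P" by (auto simp: face_iff)
  then have "compact (face P J)"
    using T closed_face bounded_subset by (metis compact_eq_bounded_closed)
  then obtain v where v: "v extreme_point_of face P J"
    using extreme_point_exists_convex[OF _ convex_face[OF T(1)] ne] by blast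
  then have "v extreme_point_of body P" "v \<in> face P J"
    using extreme_point_of_face[OF face_face_of[OF T(1) J]] by (auto simp: extreme_point_of_def)
  then show ?thesis using that J facets_at_iff by (fastforce simp: face_iff)
qed

section \<open>Stability of simple polytopes under perturbation\<close>

lemma eventually_affine_less:
  fixes a b c d :: real
  assumes "a < c"
  shows "\<forall>\<^sub>F t in nhds 0. a + t * b < c + t * d"
proof -
  have "((\<lambda>t. (c + t * d) - (a + t * b)) \<longlongrightarrow> (c + 0 * d) - (a + 0 * b)) (nhds (0::real))"
    by (intro tendsto_intros filterlim_ident)
  then have "\<forall>\<^sub>F t in nhds 0. 0 < (c + t * d) - (a + t * b)"
    by (rule order_tendstoD(1)) (use assms in simp)
  then show ?thesis by eventually_elim simp
qed

text \<open>Each basis formed by conormals determines a point whose dependence on \<open>t\<close> is affine. If the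
  point for \<open>t = 0\<close> lies in the body, it is a vertex and, by simplicity, all further inequalities are
  strict there; otherwise it violates an inequality. Both situations persist for small \<open>t\<close>.\<close>

lemma perturbed_basis_vertex:
  fixes P :: "('i, 'a::euclidean_space) presentation" and \<delta> :: "'i \<Rightarrow> real"
  assumes P: "is_simple P" and B: "B \<subseteq> index P" "inj_on (conormal P) B"
      "independent (conormal P ` B)" "span (conormal P ` B) = vspace P"
  defines "Pt \<equiv> \<lambda>t. P\<lparr>supp := \<lambda>i. supp P i + t * \<delta> i\<rparr>"
  shows "\<forall>\<^sub>F t in nhds 0. \<forall>x. B \<subseteq> facets_at (Pt t) x \<longrightarrow> facets_at (Pt t) x = B"
proof -
  let ?T = "vspace P"
  have pol: "is_polytope P" and T: "subspace ?T" and fin: "finite (index P)"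
    using P by (auto simp: is_simple_def is_polytope_def)
  obtain v where v: "v \<in> ?T" "\<And>i. i \<in> B \<Longrightarrow> conormal P i \<bullet> v = supp P i"
    using basis_solve[OF B(2-4), of "supp P"] by blast
  obtain w where w: "w \<in> ?T" "\<And>i. i \<in> B \<Longrightarrow> conormal P i \<bullet> w = \<delta> i"
    using basis_solve[OF B(2-4), of \<delta>] by blast
  have eqx: "x = v + t *\<^sub>R w" if "B \<subseteq> facets_at (Pt t) x" and xb: "x \<in> body (Pt t)" for x t
  proof -
    have "x - (v + t *\<^sub>R w) = 0"
    proof (rule spanning_inner_zeroI[OF B(4)])
      show "x - (v + t *\<^sub>R w) \<in> ?T"
        using xb v w T by (auto simp: body_iff Pt_def intro!: subspace_diff subspace_add subspace_scale)
      fix b assume "b \<in> conormal P ` B"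
      then obtain i where i: "i \<in> B" "b = conormal P i" by blast
      have "conormal P i \<bullet> x = supp P i + t * \<delta> i"
        using that(1) i facets_at_iff[OF xb] by (auto simp: Pt_def)
      then show "b \<bullet> (x - (v + t *\<^sub>R w)) = 0"
        using i v w by (simp add: inner_diff_right inner_add_right)
    qed
    then show ?thesis by simp
  qed
  show ?thesis
  proof (cases "v \<in> body P")
    case True
    have Bv: "B \<subseteq> facets_at P v" using facets_at_iff[OF True] v(2) B(1) by auto
    have ext: "v extreme_point_of body P" by (rule extreme_pointI[OF T True B(4) Bv])
    have "card B = card (facets_at P v)"
      using simple_vertex_basis(4)[OF P ext] B(2-4)
      by (metis card_image dim_eq_card dim_span)
    then have "B = facets_at P v"
      using simple_vertex_basis(5)[OF P ext] Bv card_subset_eq by metis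
    then have less: "conormal P i \<bullet> v < supp P i" if "i \<in> index P - B" for i
      using that True facets_at_iff[OF True] by (force simp: body_iff less_le)
    have "\<forall>\<^sub>F t in nhds 0. \<forall>i\<in>index P - B.
        conormal P i \<bullet> v + t * (conormal P i \<bullet> w) < supp P i + t * \<delta> i"
      by (intro eventually_ball_finite ballI eventually_affine_less less) (use fin in auto)
    then show ?thesis
    proof eventually_elim
      case (elim t)
      show ?case
      proof (intro allI impI)
        fix x assume x: "B \<subseteq> facets_at (Pt t) x"
        show "facets_at (Pt t) x = B"
        proof (rule ccontr)
          assume ne: "facets_at (Pt t) x \<noteq> B"
          then obtain i where i: "i \<in> facets_at (Pt t) x" "i \<notin> B" using x by blast
          then have xb: "x \<in> body (Pt t)" by (auto simp: facets_at_def facet_def)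
          then have "x = v + t *\<^sub>R w" using eqx x by blast
          then show False using i facets_at_iff[OF xb, of i] elim
            by (force simp: Pt_def inner_add_right)
        qed
      qed
    qed
  next
    case False
    then obtain i where i: "i \<in> index P" "supp P i < conormal P i \<bullet> v"
      using v(1) by (auto simp: body_iff not_le)
    have "\<forall>\<^sub>F t in nhds 0. supp P i + t * \<delta> i < conormal P i \<bullet> v + t * (conormal P i \<bullet> w)"
      by (rule eventually_affine_less[OF i(2)])
    then show ?thesis
    proof eventually_elim
      case (elim t)
      have "x \<notin> body (Pt t)" if "B \<subseteq> facets_at (Pt t) x" for x
      proof
        assume xb: "x \<in> body (Pt t)"
        then have "x = v + t *\<^sub>R w" using eqx that by blast
        then have "conormal P i \<bullet> v + t * (conormal P i \<bullet> w) \<le> supp P i + t * \<delta> i"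
          using xb i(1) by (simp add: body_iff Pt_def inner_add_right)
        then show False using elim by simp
      qed
      then show ?case by (fastforce simp: facets_at_def facet_def)
    qed
  qed
qed

text \<open>The interior point and the strict points on the facets witness that the perturbed presentation is
  a polytope. Its vertices are determined by bases among the active conormals, so that simplicity
  follows from \<open>perturbed_basis_vertex\<close>.\<close>

lemma simple_perturb:
  fixes P :: "('i, 'a::euclidean_space) presentation"
  assumes P: "is_simple P"
  shows "\<forall>\<^sub>F t in nhds 0. is_simple (P\<lparr>supp := \<lambda>i. supp P i + t * \<delta> i\<rparr>)"
proof -
  let ?T = "vspace P" and ?Pt = "\<lambda>t. P\<lparr>supp := \<lambda>i. supp P i + t * \<delta> i\<rparr>"
  have pol: "is_polytope P" and T: "subspace ?T" and fin: "finite (index P)" and bd: "bounded (body P)"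
    and con: "\<And>i. i \<in> index P \<Longrightarrow> conormal P i \<in> ?T \<and> conormal P i \<noteq> 0"
    using P by (auto simp: is_simple_def is_polytope_def)
  obtain x0 where x0: "x0 \<in> ?T" "\<And>i. i \<in> index P \<Longrightarrow> conormal P i \<bullet> x0 < supp P i"
    using polytope_interior_point[OF pol] by blast
  have "\<forall>i\<in>index P. \<exists>y. y \<in> ?T \<and> conormal P i \<bullet> y = supp P i \<and>
    (\<forall>j\<in>index P - {i}. conormal P j \<bullet> y < supp P j)"
    using polytope_facet_point[OF pol] by (metis DiffE singletonI)
  then obtain y where y: "\<And>i. i \<in> index P \<Longrightarrow> y i \<in> ?T \<and> conormal P i \<bullet> y i = supp P i \<and>
    (\<forall>j\<in>index P - {i}. conormal P j \<bullet> y i < supp P j)" by metis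
  define z where "z i = (\<delta> i / (conormal P i \<bullet> conormal P i)) *\<^sub>R conormal P i" for i
  have z: "z i \<in> ?T" "conormal P i \<bullet> z i = \<delta> i" if "i \<in> index P" for i
    using con[OF that] T by (simp_all add: z_def subspace_scale)
  \<comment> \<open>Conditions 1 and 3 preserve the strict points, 2 yields boundedness, 4 controls the vertices.\<close>
  have 1: "\<forall>\<^sub>F t in nhds 0. \<forall>i\<in>index P. conormal P i \<bullet> x0 + t * 0 < supp P i + t * \<delta> i"
    by (intro eventually_ball_finite ballI eventually_affine_less fin x0)
  have 2: "\<forall>\<^sub>F t in nhds 0. \<forall>i\<in>index P. conormal P i \<bullet> x0 + t * \<delta> i < supp P i + t * 0"
    by (intro eventually_ball_finite ballI eventually_affine_less fin x0)
  have 3: "\<forall>\<^sub>F t in nhds 0. \<forall>i\<in>index P. \<forall>j\<in>index P - {i}.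
      conormal P j \<bullet> y i + t * (conormal P j \<bullet> z i) < supp P j + t * \<delta> j"
    using y fin by (intro eventually_ball_finite ballI eventually_affine_less) auto
  have 4: "\<forall>\<^sub>F t in nhds 0. \<forall>B\<in>{B. B \<subseteq> index P \<and> inj_on (conormal P) B \<and>
      independent (conormal P ` B) \<and> span (conormal P ` B) = ?T}.
      \<forall>x. B \<subseteq> facets_at (?Pt t) x \<longrightarrow> facets_at (?Pt t) x = B"
  proof (intro eventually_ball_finite ballI)
    show "finite {B. B \<subseteq> index P \<and> inj_on (conormal P) B \<and>
      independent (conormal P ` B) \<and> span (conormal P ` B) = ?T}"
      by (rule finite_subset[of _ "Pow (index P)"]) (use fin in auto)
  qed (use perturbed_basis_vertex[OF P] in auto)
  show ?thesis
    using 1 2 3 4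
  proof eventually_elim
    case (elim t)
    let ?Q = "?Pt t"
    have "is_polytope ?Q"
    proof (rule is_polytopeI)
      \<comment> \<open>The midpoint of \<open>x0\<close> and a point of the perturbed body lies in the original body.\<close>
      show "bounded (body ?Q)"
      proof (rule bounded_subset)
        show "bounded ((\<lambda>x. (-x0) + 2 *\<^sub>R x) ` body P)"
          using bounded_translation[OF bounded_scaling[OF bd, of 2], of "-x0"]
          by (simp add: image_image)
        show "body ?Q \<subseteq> (\<lambda>x. (-x0) + 2 *\<^sub>R x) ` body P"
        proof
          fix x assume x: "x \<in> body ?Q"
          have "(1/2) *\<^sub>R (x0 + x) \<in> body P"
          proof -
            have "conormal P i \<bullet> ((1/2) *\<^sub>R (x0 + x)) \<le> supp P i" if i: "i \<in> index P" for i
            proof -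
              have "conormal P i \<bullet> x \<le> supp P i + t * \<delta> i" using x i by (simp add: body_iff)
              then show ?thesis using elim(2) i by (fastforce simp: inner_add_right)
            qed
            then show ?thesis using x x0 T by (simp add: body_iff subspace_add subspace_scale)
          qed
          moreover have "x = (-x0) + 2 *\<^sub>R ((1/2) *\<^sub>R (x0 + x))" by simp
          ultimately show "x \<in> (\<lambda>x. (-x0) + 2 *\<^sub>R x) ` body P" by blast
        qed
      qed
      show "\<exists>x\<in>vspace ?Q. \<forall>i\<in>index ?Q. conormal ?Q i \<bullet> x < supp ?Q i"
        using elim(1) x0 by auto
      fix i assume i: "i \<in> index ?Q"
      have "y i + t *\<^sub>R z i \<in> ?T" using y z i T by (simp add: subspace_add subspace_scale)
      then show "\<exists>x\<in>vspace ?Q. conormal ?Q i \<bullet> x = supp ?Q i \<and>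
          (\<forall>j\<in>index ?Q - {i}. conormal ?Q j \<bullet> x < supp ?Q j)"
        using i y z elim(3) by (intro bexI[of _ "y i + t *\<^sub>R z i"]) (auto simp: inner_add_right)
    qed (use T fin con in auto)
    moreover have "card (facets_at ?Q v) = dim (vspace ?Q)" if v: "v extreme_point_of body ?Q" for v
    proof -
      have sp: "span (conormal P ` facets_at ?Q v) = ?T"
        using extreme_point_span[OF _ _ _ v] T fin con by simp
      \<comment> \<open>The active conormals at a vertex span the space; a basis among them forces all active
      indices to belong to it.\<close>
      obtain C where C: "C \<subseteq> conormal P ` facets_at ?Q v" "independent C"
          "conormal P ` facets_at ?Q v \<subseteq> span C"
        using maximal_independent_subset by blast
      then have spC: "span C = ?T" using sp
        by (metis span_eq span_mono subset_antisym span_minimal subspace_span)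
      obtain B where B: "B \<subseteq> facets_at ?Q v" "inj_on (conormal P) B" "C = conormal P ` B"
        using subset_image_inj[of C "conormal P" "facets_at ?Q v"] C(1) by metis
      have "B \<subseteq> index P" using B by (auto simp: facets_at_def)
      then have "facets_at ?Q v = B" using elim(4) B C spC by simp
      moreover have "card B = dim ?T"
        using B C spC by (metis card_image dim_eq_card dim_span)
      ultimately show ?thesis by simp
    qed
    ultimately show ?case by (simp add: is_simple_def)
  qed
qed

lemma perturbation_in_chamber:
  fixes P :: "('i, 'a::euclidean_space) presentation"
  assumes P: "is_simple P"
  obtains t where "t > 0" "(\<lambda>i. supp P i + t * \<delta> i) \<in> chamber P" "supp P \<in> chamber P"
proof -
  let ?S = "{\<kappa>. is_simple (P\<lparr>supp := \<kappa>\<rparr>)}"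
  let ?g = "\<lambda>t i. supp P i + t * \<delta> i"
  obtain d where d: "d > 0" "\<And>t. \<bar>t\<bar> < d \<Longrightarrow> is_simple (P\<lparr>supp := ?g t\<rparr>)"
    using simple_perturb[OF P, of \<delta>] by (auto simp: eventually_nhds_metric)
  let ?C = "?g ` {0..d/2}"
  have "continuous_on {0..d/2} ?g"
    by (intro continuous_on_coordinatewise_then_product continuous_intros)
  then have "connected ?C" by (intro connected_continuous_image connected_Icc)
  moreover have "?C \<subseteq> ?S" using d by auto
  moreover have "supp P \<in> ?C" using d(1) by (intro image_eqI[of _ _ 0]) auto
  ultimately have C: "?C \<subseteq> chamber P"
    unfolding chamber_def by (intro connected_component_maximal)
  show ?thesis
  proof (rule that)
    show "?g (d/2) \<in> chamber P" by (rule subsetD[OF C], rule imageI) (use d(1) in simp)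
  qed (use C d(1) \<open>supp P \<in> ?C\<close> in auto)
qed

section \<open>Integer spans and lattice bases\<close>

lemma int_span_add:
  assumes "v \<in> int_span B" "w \<in> int_span B"
  shows "v + w \<in> int_span B"
proof -
  obtain c d where "v = (\<Sum>b\<in>B. real_of_int (c b) *\<^sub>R b)" "w = (\<Sum>b\<in>B. real_of_int (d b) *\<^sub>R b)"
    using assms by (auto simp: int_span_def)
  then have "v + w = (\<Sum>b\<in>B. real_of_int (c b + d b) *\<^sub>R b)"
    by (simp add: sum.distrib scaleR_add_left)
  then show ?thesis unfolding int_span_def by (intro CollectI exI[of _ "\<lambda>b. c b + d b"]) simp
qed

lemma int_span_scale:
  assumes "v \<in> int_span B"
  shows "real_of_int m *\<^sub>R v \<in> int_span B"
proof -
  obtain c where "v = (\<Sum>b\<in>B. real_of_int (c b) *\<^sub>R b)" using assms by (auto simp: int_span_def)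
  then have "real_of_int m *\<^sub>R v = (\<Sum>b\<in>B. real_of_int (m * c b) *\<^sub>R b)"
    by (simp add: scaleR_sum_right)
  then show ?thesis
    unfolding int_span_def by (intro CollectI exI[of _ "\<lambda>b. m * c b"]) simp
qed

lemma int_span_zero: "0 \<in> int_span B"
  unfolding int_span_def by (intro CollectI exI[of _ "\<lambda>_. 0"]) simp

lemma int_span_base:
  assumes "finite B" "b \<in> B"
  shows "b \<in> int_span B"
proof -
  have "b = (\<Sum>x\<in>B. real_of_int (if x = b then 1 else 0) *\<^sub>R x)"
    using assms by (simp add: if_distrib[of real_of_int] if_distrib[of "\<lambda>r. r *\<^sub>R _"] cong: if_cong)
  then show ?thesis
    unfolding int_span_def by (intro CollectI exI[of _ "\<lambda>x. if x = b then 1 else 0"]) simp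
qed

lemma int_span_subset_span: "int_span B \<subseteq> span B"
proof
  fix v assume "v \<in> int_span B"
  then obtain c where "v = (\<Sum>b\<in>B. real_of_int (c b) *\<^sub>R b)" by (auto simp: int_span_def)
  then show "v \<in> span B" by (simp add: span_sum span_scale span_base)
qed

lemma int_span_sum:
  assumes "\<And>i. i \<in> A \<Longrightarrow> v i \<in> int_span B"
  shows "(\<Sum>i\<in>A. real_of_int (m i) *\<^sub>R v i) \<in> int_span B"
  using assms
  by (induction A rule: infinite_finite_induct)
    (auto intro!: int_span_zero int_span_add int_span_scale)

lemma int_span_diff: "v \<in> int_span B \<Longrightarrow> w \<in> int_span B \<Longrightarrow> v - w \<in> int_span B"
  using int_span_add[of v B "real_of_int (-1) *\<^sub>R w"] int_span_scale[of w B "-1"] by simp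

lemma int_span_minimal:
  assumes "B \<subseteq> int_span C"
  shows "int_span B \<subseteq> int_span C"
proof
  fix v assume "v \<in> int_span B"
  then obtain c where "v = (\<Sum>b\<in>B. real_of_int (c b) *\<^sub>R b)" by (auto simp: int_span_def)
  then show "v \<in> int_span C" using assms by (auto intro!: int_span_sum)
qed

lemma int_span_image:
  assumes "linear q" "finite B"
  shows "q ` int_span B = int_span (q ` B)"
proof
  show "q ` int_span B \<subseteq> int_span (q ` B)"
  proof
    fix y assume "y \<in> q ` int_span B"
    then obtain c where "y = q (\<Sum>b\<in>B. real_of_int (c b) *\<^sub>R b)" by (auto simp: int_span_def)
    then have "y = (\<Sum>b\<in>B. real_of_int (c b) *\<^sub>R q b)"
      by (simp add: linear_sum[OF assms(1)] linear_cmul[OF assms(1)])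
    then show "y \<in> int_span (q ` B)" using assms(2) by (auto intro!: int_span_sum int_span_base)
  qed
  show "int_span (q ` B) \<subseteq> q ` int_span B"
  proof
    fix y assume "y \<in> int_span (q ` B)"
    then obtain c where c: "y = (\<Sum>b\<in>q ` B. real_of_int (c b) *\<^sub>R b)" by (auto simp: int_span_def)
    \<comment> \<open>Preimages are chosen because \<open>q\<close> need not be injective on \<open>B\<close>.\<close>
    obtain C where C: "C \<subseteq> B" "inj_on q C" "q ` B = q ` C"
      using subset_image_inj[of "q ` B" q B] by auto
    have "y = q (\<Sum>b\<in>C. real_of_int (c (q b)) *\<^sub>R b)"
      unfolding c C(3) sum.reindex[OF C(2)]
      by (simp add: linear_sum[OF assms(1)] linear_cmul[OF assms(1)])
    moreover have "(\<Sum>b\<in>C. real_of_int (c (q b)) *\<^sub>R b) \<in> int_span B"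
      using C(1) assms(2) by (auto intro!: int_span_sum int_span_base)
    ultimately show "y \<in> q ` int_span B" by blast
  qed
qed

lemma lattice_basis_multiple_int:
  assumes B: "is_lattice_basis T L B" and b: "b \<in> B" and r: "r *\<^sub>R b \<in> L"
  shows "r \<in> \<int>"
proof -
  have ind: "independent B" and fin: "finite B" and L: "L = int_span B"
    using B by (auto simp: is_lattice_basis_def independent_imp_finite)
  obtain c where c: "r *\<^sub>R b = (\<Sum>x\<in>B. real_of_int (c x) *\<^sub>R x)"
    using r L by (auto simp: int_span_def)
  have 0: "(\<Sum>x\<in>B. (real_of_int (c x) - (if x = b then r else 0)) *\<^sub>R x) = 0"
    using c fin b
    by (simp add: scaleR_diff_left sum_subtractf if_distrib[of "\<lambda>r. r *\<^sub>R _"] cong: if_cong)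
  have "real_of_int (c b) - (if b = b then r else 0) = 0"
    by (rule independentD[OF ind fin subset_refl 0 b])
  then show ?thesis by (metis Ints_of_int eq_iff_diff_eq_0)
qed

lemma lattice_basis_primitive:
  assumes B: "is_lattice_basis T L B" and b: "b \<in> B"
  shows "primitive L b"
  unfolding primitive_def
proof (intro conjI ballI allI impI)
  have ind: "independent B" and fin: "finite B" and L: "L = int_span B"
    using B by (auto simp: is_lattice_basis_def independent_imp_finite)
  show "b \<in> L" using int_span_base[OF fin b] L by simp
  show nz: "b \<noteq> 0" using ind b dependent_zero by blast
  fix w and m :: nat
  assume w: "w \<in> L" "b = real m *\<^sub>R w"
  then have m: "m \<noteq> 0" using nz by auto
  then have "w = inverse (real m) *\<^sub>R b" using w by simp
  then have "inverse (real m) \<in> \<int>" using lattice_basis_multiple_int[OF B b] w by simp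
  then obtain z where z: "inverse (real m) = real_of_int z" by (auto elim: Ints_cases)
  then have "real_of_int (z * int m) = 1" using m by (simp flip: z)
  then have "z * int m = 1" by (simp only: of_int_eq_1_iff)
  then show "m = 1" using pos_zmult_eq_1_iff_lemma[of z "int m"] m by (auto simp: zmult_eq_1_iff)
qed

lemma int_span_inner_int:
  assumes "v \<in> int_span B" "\<And>b. b \<in> B \<Longrightarrow> b \<bullet> x \<in> \<int>"
  shows "v \<bullet> x \<in> \<int>"
proof -
  obtain c where "v = (\<Sum>b\<in>B. real_of_int (c b) *\<^sub>R b)" using assms(1) by (auto simp: int_span_def)
  then have "v \<bullet> x = (\<Sum>b\<in>B. real_of_int (c b) * (b \<bullet> x))" by (simp add: inner_sum_left)
  then show ?thesis using assms(2) by (auto intro!: Ints_sum Ints_mult)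
qed

section \<open>Symmetries and separating vectors of equivalent facets\<close>

lemma symmetry_linear_part_surj:
  assumes P: "is_polytope P" and s: "is_symmetry P f c"
  shows "f ` vspace P = vspace P"
proof
  let ?T = "vspace P"
  have T: "subspace ?T" "affine hull (body P) = ?T" using P by (auto simp: is_polytope_def)
  have f: "linear f" "f ` ?T \<subseteq> ?T" "c \<in> ?T" "(\<lambda>x. f x + c) ` body P = body P"
    using s by (auto simp: is_symmetry_def)
  show "f ` ?T \<subseteq> ?T" by (rule f)
  have "body P \<subseteq> (+) c ` (f ` ?T)"
    using f(4) by (force simp: body_iff add.commute)
  moreover have "affine ((+) c ` (f ` ?T))"
    using affine_translation subspace_imp_affine[OF linear_subspace_image[OF f(1) T(1)]] by blast
  ultimately have "?T \<subseteq> (+) c ` (f ` ?T)" using T(2) hull_minimal by metis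
  then have "c + y \<in> (+) c ` (f ` ?T)" if "y \<in> ?T" for y
    using that f(3) T(1) subspace_add by blast
  then have "y \<in> f ` ?T" if "y \<in> ?T" for y using that by fastforce
  then show "?T \<subseteq> f ` ?T" by blast
qed

lemma symmetry_dual_map_inj:
  assumes P: "is_polytope P" and s: "is_symmetry P f c" and v: "v \<in> vspace P" "w \<in> vspace P"
    and eq: "dual_map (vspace P) f v = dual_map (vspace P) f w"
  shows "v = w"
proof -
  have T: "subspace (vspace P)" and f: "linear f"
    using P s by (auto simp: is_polytope_def is_symmetry_def)
  show ?thesis
  proof (rule subspace_inner_eqI[OF T v])
    fix x assume "x \<in> vspace P"
    then obtain z where "z \<in> vspace P" "x = f z"
      using symmetry_linear_part_surj[OF P s] by blast
    then show "v \<bullet> x = w \<bullet> x" using dual_map_props(2)[OF T f] eq by metis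
  qed
qed

text \<open>Both sides are the maximum of the functional with conormal \<open>m\<close> on the body, which equals its own
  image under the symmetry.\<close>

lemma symmetry_supp:
  assumes P: "is_polytope P" and s: "is_symmetry P f c"
    and m: "m \<in> index P" "m' \<in> index P" "dual_map (vspace P) f (conormal P m) = conormal P m'"
  shows "supp P m = supp P m' + conormal P m \<bullet> c"
proof -
  have T: "subspace (vspace P)" and f: "linear f" and im: "(\<lambda>x. f x + c) ` body P = body P"
    using P s by (auto simp: is_polytope_def is_symmetry_def)
  have ev: "conormal P m \<bullet> (f x + c) = conormal P m' \<bullet> x + conormal P m \<bullet> c" if "x \<in> body P" for x
    using dual_map_props(2)[OF T f, of x "conormal P m"] that m(3)
    by (simp add: inner_add_right body_iff)
  have ex: "\<exists>y\<in>body P. conormal P i \<bullet> y = supp P i" if i: "i \<in> index P" for i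
    using polytope_facet_nonempty[OF P i] by (auto simp: facet_iff)
  obtain y where y: "y \<in> body P" "conormal P m' \<bullet> y = supp P m'" using ex m(2) by blast
  have "f y + c \<in> body P" using im y(1) by blast
  then have "conormal P m \<bullet> (f y + c) \<le> supp P m" using m(1) by (simp add: body_iff)
  then have 1: "supp P m' + conormal P m \<bullet> c \<le> supp P m" using ev y by simp
  obtain z where z: "z \<in> body P" "conormal P m \<bullet> z = supp P m" using ex m(1) by blast
  then obtain x where x: "x \<in> body P" "z = f x + c" using im by blast
  then have "conormal P m' \<bullet> x \<le> supp P m'" using m(2) by (simp add: body_iff)
  then show ?thesis using 1 ev[OF x(1)] z x by simp
qed

text \<open>The preimage \<open>G\<close> of the facet \<open>m\<close> under the symmetry is convex and contains no interior point of the
  body, so it lies in some facet \<open>m'\<close>. As \<open>G\<close> spans a hyperplane, the dual image of the conormal \<open>m\<close>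
  is a multiple of the conormal \<open>m'\<close>, and a positive one because both functionals attain
  their maximum over the body on \<open>G\<close>. Both vectors are primitive, hence equal.\<close>

lemma smooth_symmetry_permutes_conormals:
  assumes P: "is_smooth P L" and L: "vlattice P = Some L" and s: "is_symmetry P f c"
    and m: "m \<in> index P"
  shows "\<exists>m'\<in>index P. dual_map (vspace P) f (conormal P m) = conormal P m'"
proof -
  let ?T = "vspace P"
  have sim: "is_simple P" and pol: "is_polytope P" and T: "subspace ?T" and fin: "finite (index P)"
    and con: "\<And>i. i \<in> index P \<Longrightarrow> conormal P i \<in> ?T \<and> conormal P i \<noteq> 0"
    using P by (auto simp: is_smooth_def is_simple_def is_polytope_def)
  have f: "linear f" "c \<in> ?T" "(\<lambda>x. f x + c) ` body P = body P" "dual_map ?T f ` L = L" "f ` ?T \<subseteq> ?T"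
    using s L by (auto simp: is_symmetry_def)
  note surj = symmetry_linear_part_surj[OF pol s]
  define b where "b = dual_map ?T f (conormal P m)"
  have b: "b \<in> ?T" "\<And>x. x \<in> ?T \<Longrightarrow> b \<bullet> x = conormal P m \<bullet> f x"
    using dual_map_props[OF T f(1)] by (auto simp: b_def)
  obtain B where B: "is_lattice_basis ?T L B" using P by (auto simp: is_smooth_def is_lattice_def)
  have Bf: "span B = ?T" "B \<subseteq> L" "finite B" "L = int_span B"
    using B int_span_base[of B] independent_imp_finite by (auto simp: is_lattice_basis_def)
  have LT: "L \<subseteq> ?T"
    using int_span_subset_span[of B] Bf by simp
  \<comment> \<open>\<open>f\<close> is injective on the space since its dual map is onto the lattice, which spans the space.\<close>
  have inj: "u = 0" if u: "u \<in> ?T" "f u = 0" for u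
  proof (rule spanning_inner_zeroI[OF Bf(1) u(1)])
    fix x assume "x \<in> B"
    then obtain x' where "x = dual_map ?T f x'" using Bf(2) f(4) by blast
    then show "x \<bullet> u = 0" using dual_map_props(2)[OF T f(1) u(1)] u(2) by simp
  qed
  define G where "G = body P \<inter> {x. b \<bullet> x = supp P m - conormal P m \<bullet> c}"
  have Giff: "x \<in> G \<longleftrightarrow> x \<in> body P \<and> conormal P m \<bullet> (f x + c) = supp P m" for x
    using b(2) by (auto simp: G_def body_iff inner_add_right)
  have Gconv: "convex G" unfolding G_def
    by (intro convex_Int convex_body T convex_hyperplane)
  obtain y where y: "y \<in> ?T" "conormal P m \<bullet> y = supp P m"
      "\<And>j. j \<in> index P \<Longrightarrow> j \<noteq> m \<Longrightarrow> conormal P j \<bullet> y < supp P j"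
    by (rule polytope_facet_point[OF pol m]) blast
  have "y \<in> body P" using y unfolding body_iff by (metis less_eq_real_def)
  then obtain g where g: "g \<in> body P" "y = f g + c" using f(3) by blast
  then have gG: "g \<in> G" using Giff y by simp
  \<comment> \<open>Otherwise \<open>G\<close> contains an interior point of the body, from which the functional of the
    facet \<open>m\<close>, composed with the symmetry, could still be increased.\<close>
  have "\<exists>m'\<in>index P. \<forall>x\<in>G. conormal P m' \<bullet> x = supp P m'"
  proof (rule ccontr)
    assume no: "\<not> ?thesis"
    have "\<exists>x\<in>G. \<forall>i\<in>index P. conormal P i \<bullet> x < supp P i"
      by (intro strict_common_point fin Gconv) (use gG no in \<open>auto simp: Giff body_iff\<close>)
    then obtain x where x: "x \<in> G" "\<And>i. i \<in> index P \<Longrightarrow> conormal P i \<bullet> x < supp P i" by blast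
    obtain u where u: "u \<in> ?T" "f u = conormal P m" using surj con[OF m] by (metis imageE)
    obtain e where e: "e > 0" "\<And>i. i \<in> index P \<Longrightarrow> conormal P i \<bullet> (x + e *\<^sub>R u) < supp P i"
      using interior_step[OF fin x(2), of u] by blast
    have "x + e *\<^sub>R u \<in> body P"
      using e x(1) u T by (auto simp: Giff body_iff subspace_add subspace_scale less_imp_le)
    then have "f (x + e *\<^sub>R u) + c \<in> body P" using f(3) by blast
    then have "conormal P m \<bullet> (f (x + e *\<^sub>R u) + c) \<le> supp P m" using m by (simp add: body_iff)
    then have "e * (conormal P m \<bullet> conormal P m) \<le> 0"
      using x(1) by (simp add: Giff linear_add[OF f(1)] linear_cmul[OF f(1)] inner_add_right u)
    then show False using e(1) con[OF m] by (metis inner_gt_zero_iff mult_pos_pos not_le)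
  qed
  then obtain m' where m': "m' \<in> index P" and Gm': "\<And>x. x \<in> G \<Longrightarrow> conormal P m' \<bullet> x = supp P m'"
    by blast
  have bnz: "b \<noteq> 0"
  proof
    assume "b = 0"
    then have "conormal P m \<bullet> x = 0" if "x \<in> ?T" for x
      using b(2) surj that by (metis imageE inner_zero_left)
    then show False using con[OF m] by force
  qed
  obtain \<rho> where \<rho>: "conormal P m' = \<rho> *\<^sub>R b"
  proof (rule inner_kernel_imp_multiple[OF T, of "conormal P m'" b])
    fix u assume u: "u \<in> ?T" "b \<bullet> u = 0"
    have fu: "f u \<in> ?T" "conormal P m \<bullet> f u = 0" using u b(2) f(5) by auto
    obtain e where e: "e > 0"
      "\<And>i. i \<in> index P - {m} \<Longrightarrow> conormal P i \<bullet> (y + e *\<^sub>R f u) < supp P i"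
      using interior_step[of "index P - {m}" P y "f u"] fin y(3) by auto
    have "conormal P i \<bullet> (y + e *\<^sub>R f u) \<le> supp P i" if "i \<in> index P" for i
      using that e(2)[of i] fu(2) y(2) by (cases "i = m") (auto simp: inner_add_right)
    then have "y + e *\<^sub>R f u \<in> body P"
      using y(1) fu T by (simp add: body_iff subspace_add subspace_scale)
    then obtain x where x: "x \<in> body P" "y + e *\<^sub>R f u = f x + c" using f(3) by fast
    have "f (x - (g + e *\<^sub>R u)) = 0"
      using x(2) g(2) by (simp add: linear_diff[OF f(1)] linear_add[OF f(1)] linear_cmul[OF f(1)])
    then have "x - (g + e *\<^sub>R u) = 0"
      by (rule inj[rotated]) (use x(1) g(1) u(1) T in \<open>auto simp: body_iff subspace_add subspace_scale subspace_diff\<close>)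
    then have xg: "x = g + e *\<^sub>R u" by simp
    have "x \<in> G" using x fu(2) y(2) by (simp add: Giff inner_add_right flip: x(2))
    then have "conormal P m' \<bullet> (g + e *\<^sub>R u) = conormal P m' \<bullet> g"
      using Gm' gG unfolding xg by metis
    then show "conormal P m' \<bullet> u = 0" using e(1) by (simp add: inner_add_right)
  qed (use con m' b bnz in auto)
  have "\<rho> > 0"
  proof -
    obtain x0 where x0: "x0 \<in> ?T" "\<And>i. i \<in> index P \<Longrightarrow> conormal P i \<bullet> x0 < supp P i"
      by (rule polytope_interior_point[OF pol]) blast
    have x0b: "x0 \<in> body P" using x0 by (auto simp: body_iff less_imp_le)
    then have "f x0 + c \<in> body P" using f(3) by blast
    then have "conormal P m \<bullet> (f x0 + c) \<le> supp P m" using m by (simp add: body_iff)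
    then have "b \<bullet> x0 \<le> b \<bullet> g" using b(2) x0(1) gG g(1)
      by (auto simp: Giff body_iff inner_add_right)
    moreover have "\<rho> * (b \<bullet> x0) < \<rho> * (b \<bullet> g)"
      using x0(2)[OF m'] Gm'[OF gG] by (simp add: \<rho>)
    ultimately show ?thesis by (smt (verit) mult_left_mono_neg mult_less_cancel_left)
  qed
  have prm: "primitive L (conormal P m)" "primitive L (conormal P m')"
    using P m m' by (auto simp: is_smooth_def)
  have bL: "b \<in> L" using prm(1) f(4) by (auto simp: b_def primitive_def)
  \<comment> \<open>\<open>b\<close> is a lattice vector and the multiple by \<open>1 / \<rho>\<close> of a member of a lattice basis.\<close>
  have "inverse \<rho> \<in> \<int>"
  proof -
    have "g \<in> face P {m'}" using Gm'[OF gG] g(1) by (simp add: face_iff)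
    then have "face P {m'} \<noteq> {}" by blast
    then obtain v where v: "v extreme_point_of body P" "{m'} \<subseteq> facets_at P v"
      using nonempty_face_vertex[OF pol, of "{m'}"] m' by auto
    have "is_lattice_basis ?T L (conormal P ` facets_at P v)" using P v(1) by (simp add: is_smooth_def)
    moreover have "conormal P m' \<in> conormal P ` facets_at P v" using v(2) by blast
    moreover have "inverse \<rho> *\<^sub>R conormal P m' \<in> L" using bL \<open>\<rho> > 0\<close> by (simp add: \<rho>)
    ultimately show ?thesis by (rule lattice_basis_multiple_int)
  qed
  then obtain z where "inverse \<rho> = real_of_int z" by (auto elim: Ints_cases)
  moreover from this have "z > 0" using \<open>\<rho> > 0\<close> by (metis of_int_0_less_iff positive_imp_inverse_positive)
  ultimately have z: "inverse \<rho> = real (nat z)" by simp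
  have mL: "conormal P m' \<in> L" using prm(2) by (simp add: primitive_def)
  then obtain w where w: "w \<in> L" "conormal P m' = dual_map ?T f w" using f(4) by blast
  have "conormal P m = real (nat z) *\<^sub>R w"
  proof (rule symmetry_dual_map_inj[OF pol s])
    show "conormal P m \<in> ?T" "real (nat z) *\<^sub>R w \<in> ?T"
      using con m w(1) LT T by (auto simp: subspace_scale)
    have "dual_map ?T f (real (nat z) *\<^sub>R w) = real (nat z) *\<^sub>R dual_map ?T f w"
    proof (rule subspace_inner_eqI[OF T])
      fix x assume "x \<in> ?T"
      then show "dual_map ?T f (real (nat z) *\<^sub>R w) \<bullet> x = (real (nat z) *\<^sub>R dual_map ?T f w) \<bullet> x"
        by (simp add: dual_map_props(2)[OF T f(1)])
    qed (use dual_map_props(1)[OF T f(1)] T in \<open>auto simp: subspace_scale\<close>)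
    also have "\<dots> = b" using \<open>\<rho> > 0\<close> by (simp add: \<rho> flip: w(2) z)
    finally show "dual_map ?T f (conormal P m) = dual_map ?T f (real (nat z) *\<^sub>R w)"
      by (simp add: b_def)
  qed
  then have "nat z = 1" using prm(1) w(1) unfolding primitive_def by blast
  then have "\<rho> = 1" using z by simp
  then show ?thesis using m' \<rho> by (intro bexI[of _ m']) (simp_all add: b_def)
qed

lemma robust_permutes_conormals:
  assumes P: "is_simple_or_smooth P" "is_normalized P" and f: "is_robust P f" and m: "m \<in> index P"
    and ch: "supp P \<in> chamber P"
  shows "\<exists>m'\<in>index P. dual_map (vspace P) f (conormal P m) = conormal P m'"
proof (cases "vlattice P")
  case None
  then show ?thesis using assms by (auto simp: is_normalized_def)
next
  case (Some L)
  have "P\<lparr>supp := supp P\<rparr> = P" by simp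
  then obtain c where "is_symmetry P f c" using f ch by (metis is_robust_def)
  then show ?thesis
    using P(1) m Some smooth_symmetry_permutes_conormals[of P L f c m]
    by (simp add: is_simple_or_smooth_def)
qed

text \<open>The key lemma: \<open>\<xi>\<close> is the normalized difference of the translation vectors of the symmetries of
  the polytope and of the polytope whose facet \<open>i\<close> is pushed outwards by a small amount.\<close>

lemma equivalent_facets_separating_vector:
  fixes P :: "('i, 'a::euclidean_space) presentation"
  assumes P: "is_simple_or_smooth P" "is_normalized P"
    and ij: "i \<in> index P" "j \<in> index P" "i \<noteq> j" "equivalent_facets P i j"
  obtains \<xi> where "\<xi> \<in> vspace P" "conormal P i \<bullet> \<xi> = 1" "conormal P j \<bullet> \<xi> = -1"
    "\<And>m. m \<in> index P \<Longrightarrow> m \<noteq> i \<Longrightarrow> m \<noteq> j \<Longrightarrow> conormal P m \<bullet> \<xi> = 0"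
proof -
  let ?T = "vspace P"
  have sim: "is_simple P"
    using P(1) by (auto simp: is_simple_or_smooth_def is_smooth_def split: option.splits)
  have pol: "is_polytope P" and T: "subspace ?T"
    and con: "\<And>i. i \<in> index P \<Longrightarrow> conormal P i \<in> ?T"
    using sim by (auto simp: is_simple_def is_polytope_def)
  \<comment> \<open>The perturbation moves the facet \<open>i\<close> only.\<close>
  define \<delta> where "\<delta> m = (if m = i then 1 else 0 :: real)" for m
  obtain t where t: "t > 0" "(\<lambda>m. supp P m + t * \<delta> m) \<in> chamber P" and ch: "supp P \<in> chamber P"
    using perturbation_in_chamber[OF sim] by blast
  define \<kappa> where "\<kappa> = (\<lambda>m. supp P m + t * \<delta> m)"
  define Q where "Q = P\<lparr>supp := \<kappa>\<rparr>"
  have Q: "vspace Q = ?T" "index Q = index P" "conormal Q = conormal P" "supp Q = \<kappa>"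
    by (simp_all add: Q_def)
  have "\<kappa> \<in> {\<kappa>. is_simple (P\<lparr>supp := \<kappa>\<rparr>)}"
    using t(2) connected_component_subset unfolding chamber_def \<kappa>_def by fast
  then have polQ: "is_polytope Q" by (simp add: Q_def is_simple_def)
  have PP: "P\<lparr>supp := supp P\<rparr> = P" by simp
  obtain f where f: "is_robust P f"
    and img: "\<And>\<kappa> c. \<kappa> \<in> chamber P \<Longrightarrow> is_symmetry (P\<lparr>supp := \<kappa>\<rparr>) f c \<Longrightarrow>
           (\<lambda>x. f x + c) ` facet (P\<lparr>supp := \<kappa>\<rparr>) i = facet (P\<lparr>supp := \<kappa>\<rparr>) j"
    using ij(4) unfolding equivalent_facets_def by blast
  obtain c0 where c0: "is_symmetry P f c0" using f ch PP by (metis is_robust_def)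
  obtain c1 where c1: "is_symmetry Q f c1" using f t(2) by (auto simp: is_robust_def Q_def \<kappa>_def)
  obtain \<tau> where \<tau>: "\<And>m. m \<in> index P \<Longrightarrow> \<tau> m \<in> index P"
      "\<And>m. m \<in> index P \<Longrightarrow> dual_map ?T f (conormal P m) = conormal P (\<tau> m)"
    using robust_permutes_conormals[OF P f _ ch] by metis
  have lin: "linear f" using c0 by (simp add: is_symmetry_def)
  have \<tau>j: "\<tau> j = i"
  proof (rule ccontr)
    assume ne: "\<tau> j \<noteq> i"
    obtain y where y: "y \<in> ?T" "conormal P i \<bullet> y = supp P i"
      "\<And>l. l \<in> index P \<Longrightarrow> l \<noteq> i \<Longrightarrow> conormal P l \<bullet> y < supp P l"
      by (rule polytope_facet_point[OF pol ij(1)]) blast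
    then have "y \<in> facet P i" unfolding facet_iff body_iff by (metis less_eq_real_def)
    then have "f y + c0 \<in> facet P j" using img[OF ch] c0 unfolding PP by blast
    then have "conormal P j \<bullet> (f y + c0) = supp P j" by (simp add: facet_iff)
    then have "conormal P (\<tau> j) \<bullet> y + conormal P j \<bullet> c0 = supp P j"
      using dual_map_props(2)[OF T lin y(1), of "conormal P j"] \<tau>(2)[OF ij(2)]
      by (simp add: inner_add_right)
    then have "conormal P (\<tau> j) \<bullet> y = supp P (\<tau> j)"
      using symmetry_supp[OF pol c0 ij(2) \<tau>(1) \<tau>(2)] ij(2) by simp
    then show False using y(3)[of "\<tau> j"] ne \<tau>(1)[OF ij(2)] by simp
  qed
  \<comment> \<open>\<open>\<tau>\<close> is injective because the dual map is, and distinct facets have distinct conormals.\<close>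
  have \<tau>i: "\<tau> m = i \<longleftrightarrow> m = j" if m: "m \<in> index P" for m
  proof
    assume "\<tau> m = i"
    then have eq: "conormal P m = conormal P j"
      using symmetry_dual_map_inj[OF pol c0 con[OF m] con[OF ij(2)]] \<tau>(2) \<tau>j m ij(2) by simp
    show "m = j"
    proof (rule ccontr)
      assume ne: "m \<noteq> j"
      obtain y where y: "conormal P m \<bullet> y = supp P m" "conormal P j \<bullet> y < supp P j"
        using polytope_facet_point[OF pol m] ne ij(2) by metis
      obtain z where z: "conormal P j \<bullet> z = supp P j" "conormal P m \<bullet> z < supp P m"
        using polytope_facet_point[OF pol ij(2)] ne m by metis
      show False using y z eq by simp
    qed
  qed (use \<tau>j in simp)
  define \<xi> where "\<xi> = (1 / t) *\<^sub>R (c1 - c0)"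
  have val: "conormal P m \<bullet> \<xi> = \<delta> m - (if m = j then 1 else 0)" if m: "m \<in> index P" for m
  proof -
    have "supp P m = supp P (\<tau> m) + conormal P m \<bullet> c0"
      by (rule symmetry_supp[OF pol c0 m \<tau>(1)[OF m] \<tau>(2)[OF m]])
    moreover have "\<kappa> m = \<kappa> (\<tau> m) + conormal P m \<bullet> c1"
      using symmetry_supp[OF polQ c1, of m "\<tau> m"] m \<tau> by (simp add: Q)
    moreover have "\<delta> (\<tau> m) = (if m = j then 1 else 0)" using \<tau>i[OF m] by (simp add: \<delta>_def)
    ultimately have "t * \<delta> m - t * (if m = j then 1 else 0) = conormal P m \<bullet> (c1 - c0)"
      by (simp add: \<kappa>_def inner_diff_right)
    then have "t * (\<delta> m - (if m = j then 1 else 0)) = t * (conormal P m \<bullet> \<xi>)"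
      using t(1) by (simp add: \<xi>_def right_diff_distrib)
    then show ?thesis using t(1) by simp
  qed
  have "\<xi> \<in> ?T"
    using c0 c1 T by (simp add: \<xi>_def is_symmetry_def Q subspace_scale subspace_diff)
  then show ?thesis
    by (rule that) (use val ij in \<open>auto simp: \<delta>_def\<close>)
qed

section \<open>Faces of simple and smooth polytopes\<close>

lemma vspace_face_presentation:
  "vspace (face_presentation P J) = {x \<in> vspace P. \<forall>j\<in>J. conormal P j \<bullet> x = 0}"
  by (simp add: face_presentation_def Let_def)

lemma conormal_face_presentation:
  "conormal (face_presentation P J) i =
     riesz (vspace (face_presentation P J)) (\<lambda>x. conormal P i \<bullet> x)"
  by (simp add: face_presentation_def Let_def)

lemma vlattice_face_presentation:
  "vlattice (face_presentation P J) =
     map_option (image (\<lambda>v. riesz (vspace (face_presentation P J)) (\<lambda>x. v \<bullet> x))) (vlattice P)"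
  by (simp add: face_presentation_def Let_def)

lemma index_face_presentation:
  "index (face_presentation P J) = {i \<in> index P - J. face P (insert i J) \<noteq> {}}"
  by (simp add: face_presentation_def Let_def)

lemma supp_face_presentation:
  assumes "face P J \<noteq> {}"
  obtains p where "p \<in> face P J"
    "\<And>i. supp (face_presentation P J) i = supp P i - conormal P i \<bullet> p"
proof (rule that)
  show "(SOME p. p \<in> face P J) \<in> face P J" using assms by (metis all_not_in_conv someI)
qed (simp add: face_presentation_def Let_def)

lemma subspace_face_presentation:
  assumes "subspace (vspace P)"
  shows "subspace (vspace (face_presentation P J))"
  using assms unfolding vspace_face_presentation subspace_def
  by (auto simp: inner_add_right)

lemma conormal_face_presentation_inner:
  assumes "subspace (vspace P)" "u \<in> vspace (face_presentation P J)"
  shows "conormal (face_presentation P J) i \<bullet> u = conormal P i \<bullet> u"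
  unfolding conormal_face_presentation
  by (rule riesz_inner(2)[OF subspace_face_presentation[OF assms(1)] assms(2)])

text \<open>Starting at a vertex of the face, a step along the vector that is orthogonal to the conormals in
  \<open>J\<close> and has product \<open>-1\<close> with the other active conormals leads to such a point.\<close>

lemma simple_face_relint:
  fixes P :: "('i, 'a::euclidean_space) presentation"
  assumes P: "is_simple P" and J: "J \<subseteq> index P" and ne: "face P J \<noteq> {}"
  obtains y where "y \<in> face P J" "\<And>i. i \<in> index P - J \<Longrightarrow> conormal P i \<bullet> y < supp P i"
proof -
  have pol: "is_polytope P" and T: "subspace (vspace P)" and fin: "finite (index P)"
    using P by (auto simp: is_simple_def is_polytope_def)
  obtain v where v: "v extreme_point_of body P" "v \<in> face P J" "J \<subseteq> facets_at P v"
    by (rule nonempty_face_vertex[OF pol J ne])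
  have vb: "v \<in> body P" using v(2) by (simp add: face_iff)
  let ?A = "facets_at P v"
  obtain w where w: "w \<in> vspace P"
      "\<And>i. i \<in> ?A \<Longrightarrow> conormal P i \<bullet> w = (if i \<in> J then 0 else -1)"
    using basis_solve[OF simple_vertex_basis(1-3)[OF P v(1)], of "\<lambda>i. if i \<in> J then 0 else -1"]
    by blast
  have "conormal P i \<bullet> v < supp P i" if "i \<in> index P - ?A" for i
    using that vb facets_at_iff[OF vb] by (auto simp: body_iff less_le)
  then obtain e where e: "e > 0" "\<And>i. i \<in> index P - ?A \<Longrightarrow> conormal P i \<bullet> (v + e *\<^sub>R w) < supp P i"
    using interior_step[of "index P - ?A" P v w] fin by blast
  have strict: "conormal P i \<bullet> (v + e *\<^sub>R w) < supp P i" if "i \<in> index P - J" for i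
    using that e w(2)[of i] facets_at_iff[OF vb, of i]
    by (cases "i \<in> ?A") (auto simp: inner_add_right)
  have eq: "conormal P i \<bullet> (v + e *\<^sub>R w) = supp P i" if "i \<in> J" for i
  proof -
    have "i \<in> ?A" using that v(3) by blast
    then show ?thesis using that w(2)[of i] facets_at_iff[OF vb, of i] by (simp add: inner_add_right)
  qed
  have "conormal P i \<bullet> (v + e *\<^sub>R w) \<le> supp P i" if "i \<in> index P" for i
    using strict[of i] eq[of i] that by (cases "i \<in> J") auto
  then have "v + e *\<^sub>R w \<in> face P J"
    using eq vb w(1) T by (simp add: face_iff body_iff subspace_add subspace_scale)
  then show ?thesis using that strict by blast
qed

text \<open>The facets that miss the face are redundant for it: if a point violated only inequalities of such facets,
  the segment to it from the base point would leave the body at a common point of the face and one of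
  them.\<close>

lemma body_face_presentation:
  fixes P :: "('i, 'a::euclidean_space) presentation"
  assumes T: "subspace (vspace P)" and fin: "finite (index P)"
    and p: "p \<in> face P J" "\<And>i. supp (face_presentation P J) i = supp P i - conormal P i \<bullet> p"
  shows "x \<in> body (face_presentation P J) \<longleftrightarrow> p + x \<in> face P J"
proof
  let ?Q = "face_presentation P J"
  note inn = conormal_face_presentation_inner[OF T]
  have pT: "p \<in> vspace P" and pJ: "\<And>j. j \<in> J \<Longrightarrow> conormal P j \<bullet> p = supp P j"
    and ple: "\<And>i. i \<in> index P \<Longrightarrow> conormal P i \<bullet> p \<le> supp P i"
    using p(1) by (auto simp: face_iff body_iff)
  {
    assume "p + x \<in> face P J"
    then have px: "p + x \<in> vspace P" "\<And>j. j \<in> J \<Longrightarrow> conormal P j \<bullet> (p + x) = supp P j"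
      "\<And>i. i \<in> index P \<Longrightarrow> conormal P i \<bullet> (p + x) \<le> supp P i"
      by (auto simp: face_iff body_iff)
    have "x \<in> vspace P" using subspace_diff[OF T px(1) pT] by simp
    then have xU: "x \<in> vspace ?Q"
      using px(2) pJ by (simp add: vspace_face_presentation inner_add_right)
    moreover have "conormal ?Q i \<bullet> x \<le> supp ?Q i" if "i \<in> index ?Q" for i
      using that px(3)[of i] inn[OF xU] by (simp add: p(2) index_face_presentation inner_add_right)
    ultimately show "x \<in> body ?Q" by (simp add: body_iff)
  }
  {
    assume "x \<in> body ?Q"
    then have xU: "x \<in> vspace ?Q" and xle: "\<And>i. i \<in> index ?Q \<Longrightarrow> conormal P i \<bullet> (p + x) \<le> supp P i"
      using inn by (auto simp: body_iff p(2) inner_add_right algebra_simps)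
    have xT: "x \<in> vspace P" and xJ: "\<And>j. j \<in> J \<Longrightarrow> conormal P j \<bullet> x = 0"
      using xU by (auto simp: vspace_face_presentation)
    define V where "V = {i \<in> index P. supp P i < conormal P i \<bullet> (p + x)}"
    have "V = {}"
    proof (rule ccontr)
      assume Vne: "V \<noteq> {}"
      \<comment> \<open>\<open>l i\<close> is the time at which the segment from \<open>p\<close> to \<open>p + x\<close> crosses the hyperplane \<open>i\<close>.\<close>
      define l where "l i = (supp P i - conormal P i \<bullet> p) / (conormal P i \<bullet> x)" for i
      have Vpos: "conormal P i \<bullet> x > 0" if "i \<in> V" for i
        using that ple[of i] by (auto simp: V_def inner_add_right)
      have "finite V" using fin by (simp add: V_def)
      then obtain k where k: "k \<in> V" "\<And>i. i \<in> V \<Longrightarrow> l k \<le> l i"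
        using Vne by (metis arg_min_if_finite(1) arg_min_if_finite(2) not_less)
      have kI: "k \<in> index P" using k by (simp add: V_def)
      have l01: "0 \<le> l k" "l k \<le> 1"
        using ple[OF kI] Vpos[OF k(1)] k(1) by (auto simp: l_def V_def inner_add_right divide_simps)
      let ?z = "p + l k *\<^sub>R x"
      have zk: "conormal P k \<bullet> ?z = supp P k"
        using Vpos[OF k(1)] by (simp add: inner_add_right l_def)
      have "conormal P i \<bullet> ?z \<le> supp P i" if i: "i \<in> index P" for i
      proof (cases "i \<in> V")
        case True
        have "l k * (conormal P i \<bullet> x) \<le> l i * (conormal P i \<bullet> x)"
          using k(2)[OF True] Vpos[OF True] by (simp add: mult_right_mono)
        also have "\<dots> = supp P i - conormal P i \<bullet> p" using Vpos[OF True] by (simp add: l_def)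
        finally show ?thesis by (simp add: inner_add_right)
      next
        case False
        then have "conormal P i \<bullet> p + conormal P i \<bullet> x \<le> supp P i"
          using i by (simp add: V_def inner_add_right)
        then have "l k * (conormal P i \<bullet> p + conormal P i \<bullet> x) + (1 - l k) * (conormal P i \<bullet> p)
            \<le> l k * supp P i + (1 - l k) * supp P i"
          using ple[OF i] l01 by (intro add_mono mult_left_mono) auto
        then show ?thesis by (simp add: inner_add_right algebra_simps)
      qed
      moreover have "conormal P j \<bullet> ?z = supp P j" if "j \<in> J" for j
        using that pJ xJ by (simp add: inner_add_right)
      ultimately have "?z \<in> face P (insert k J)"
        using pT xT T zk by (simp add: face_iff body_iff subspace_add subspace_scale)
      moreover have "k \<notin> J" using Vpos[OF k(1)] xJ[of k] by auto
      ultimately have "k \<in> index ?Q" using kI by (auto simp: index_face_presentation)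
      then show False using xle[of k] k(1) by (auto simp: V_def)
    qed
    then have "conormal P i \<bullet> (p + x) \<le> supp P i" if "i \<in> index P" for i
      using that by (auto simp: V_def not_less)
    then show "p + x \<in> face P J"
      using pT xT T pJ xJ by (simp add: face_iff body_iff subspace_add inner_add_right)
  }
qed

text \<open>If part \<open>J\<close> of a basis spans \<open>W\<close>, then the classes of the remaining basis vectors form a basis of the
  quotient by \<open>W\<close>, here represented by the annihilator \<open>U\<close> of \<open>W\<close>, and the integer spans correspond.\<close>

lemma annihilator_basis:
  fixes h :: "'i \<Rightarrow> 'a::euclidean_space"
  assumes A: "finite A" "inj_on h A" "independent (h ` A)" "span (h ` A) = T" and J: "J \<subseteq> A"
  defines "U \<equiv> {x \<in> T. \<forall>j\<in>J. h j \<bullet> x = 0}"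
  defines "q \<equiv> \<lambda>v. riesz U (\<lambda>x. v \<bullet> x)"
  shows "dim U = card (A - J)" "independent ((\<lambda>i. q (h i)) ` (A - J))"
    "span ((\<lambda>i. q (h i)) ` (A - J)) = U"
    "int_span ((\<lambda>i. q (h i)) ` (A - J)) = q ` int_span (h ` A)"
proof -
  have T: "subspace T" using A(4) subspace_span by blast
  have U: "subspace U" using T by (auto simp: U_def subspace_def inner_add_right)
  have q: "linear q" unfolding q_def by (rule linear_riesz_inner[OF U])
  have q0: "q (h j) = 0" if "j \<in> J" for j
    unfolding q_def by (rule riesz_eqI) (use that U subspace_0 in \<open>auto simp: U_def\<close>)
  have indJ: "independent (h ` J)" using A(3) J by (meson image_mono independent_mono)
  have cJ: "card (h ` J) = card J" using A(2) J by (meson card_image inj_on_subset)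
  have cA: "card (h ` A) = card A" by (rule card_image[OF A(2)])
  have dT: "dim T = card A" using A(3,4) cA by (metis dim_eq_card dim_span)
  have sub: "span (h ` J) \<subseteq> T" using A(4) J by (metis image_mono span_mono)
  have "{y \<in> T. \<forall>x\<in>span (h ` J). orthogonal x y} = U"
  proof
    show "{y \<in> T. \<forall>x\<in>span (h ` J). orthogonal x y} \<subseteq> U"
      by (auto simp: U_def orthogonal_def span_base)
    show "U \<subseteq> {y \<in> T. \<forall>x\<in>span (h ` J). orthogonal x y}"
    proof
      fix u assume u: "u \<in> U"
      then have "orthogonal x u" if "x \<in> span (h ` J)" for x
      proof -
        have "orthogonal u x"
          by (rule orthogonal_to_span[OF that])
            (use u in \<open>auto simp: U_def orthogonal_def inner_commute\<close>)
        then show ?thesis by (simp add: orthogonal_commute)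
      qed
      then show "u \<in> {y \<in> T. \<forall>x\<in>span (h ` J). orthogonal x y}" using u by (simp add: U_def)
    qed
  qed
  then have "dim U + dim (span (h ` J)) = dim T"
    using dim_subspace_orthogonal_to_vectors[OF subspace_span T sub] by simp
  then have "dim U + card J = card A" using indJ cJ dT by (simp add: dim_eq_card_independent)
  then show d: "dim U = card (A - J)"
    using J A(1) by (simp add: card_Diff_subset finite_subset)
  have img: "insert 0 (q ` h ` A) = insert 0 ((\<lambda>i. q (h i)) ` (A - J))"
    using q0 J by (auto simp: image_iff)
  have "U = q ` T"
  proof
    show "U \<subseteq> q ` T"
    proof
      fix u assume u: "u \<in> U"
      then have "u = q u" unfolding q_def by (rule riesz_inner_id[OF U, symmetric])
      then show "u \<in> q ` T" using u by (auto simp: U_def)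
    qed
    show "q ` T \<subseteq> U" using riesz_inner(1)[OF U] by (auto simp: q_def)
  qed
  also have "\<dots> = span (insert 0 (q ` h ` A))"
    using linear_span_image[OF q, of "h ` A"] A(4) by (simp add: span_insert_0)
  also have "\<dots> = span ((\<lambda>i. q (h i)) ` (A - J))" unfolding img by (rule span_insert_0)
  finally show sp: "span ((\<lambda>i. q (h i)) ` (A - J)) = U" by simp
  show "independent ((\<lambda>i. q (h i)) ` (A - J))"
  proof (rule card_le_dim_spanning)
    show "(\<lambda>i. q (h i)) ` (A - J) \<subseteq> U"
      unfolding sp[symmetric] by (rule span_superset)
    show "U \<subseteq> span ((\<lambda>i. q (h i)) ` (A - J))" using sp by simp
    show "finite ((\<lambda>i. q (h i)) ` (A - J))" using A(1) by simp
    show "card ((\<lambda>i. q (h i)) ` (A - J)) \<le> dim U" unfolding d by (rule card_image_le) (use A(1) in simp)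
  qed
  have "q ` int_span (h ` A) = int_span (q ` h ` A)" by (rule int_span_image[OF q]) (use A(1) in simp)
  also have "\<dots> = int_span ((\<lambda>i. q (h i)) ` (A - J))"
  proof
    show "int_span (q ` h ` A) \<subseteq> int_span ((\<lambda>i. q (h i)) ` (A - J))"
    proof (rule int_span_minimal)
      have "q ` h ` A \<subseteq> insert 0 ((\<lambda>i. q (h i)) ` (A - J))" using img by blast
      also have "\<dots> \<subseteq> int_span ((\<lambda>i. q (h i)) ` (A - J))"
        using A(1) by (auto intro!: int_span_zero int_span_base)
      finally show "q ` h ` A \<subseteq> int_span ((\<lambda>i. q (h i)) ` (A - J))" .
    qed
    show "int_span ((\<lambda>i. q (h i)) ` (A - J)) \<subseteq> int_span (q ` h ` A)"
      using A(1) by (intro int_span_minimal) (auto intro!: int_span_base)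
  qed
  finally show "int_span ((\<lambda>i. q (h i)) ` (A - J)) = q ` int_span (h ` A)" by simp
qed

lemma extreme_point_face_presentation:
  fixes P :: "('i, 'a::euclidean_space) presentation"
  assumes P: "is_polytope P" and J: "J \<subseteq> index P"
    and p: "p \<in> face P J" "\<And>i. supp (face_presentation P J) i = supp P i - conormal P i \<bullet> p"
    and v: "v extreme_point_of body (face_presentation P J)"
  shows "p + v extreme_point_of body P" "J \<subseteq> facets_at P (p + v)"
    "facets_at (face_presentation P J) v = facets_at P (p + v) - J"
proof -
  let ?Q = "face_presentation P J"
  have T: "subspace (vspace P)" and fin: "finite (index P)"
    using P by (auto simp: is_polytope_def)
  note bodyQ = body_face_presentation[OF T fin p]
  have "face P J = (+) p ` body ?Q"
  proof (intro subset_antisym subsetI)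
    fix x assume "x \<in> face P J"
    then have "x - p \<in> body ?Q" by (simp add: bodyQ)
    then show "x \<in> (+) p ` body ?Q" by (metis add.commute diff_add_cancel imageI)
  qed (auto simp: bodyQ)
  then have ext: "p + v extreme_point_of face P J"
    using v by (simp add: extreme_point_of_translation_eq)
  then show "p + v extreme_point_of body P"
    using extreme_point_of_face[OF face_face_of[OF T J]] by blast
  have pv: "p + v \<in> face P J" "p + v \<in> body P" "v \<in> body ?Q"
    using ext v by (auto simp: extreme_point_of_def face_iff)
  then show "J \<subseteq> facets_at P (p + v)" using J facets_at_iff[OF pv(2)] by (auto simp: face_iff)
  have vU: "v \<in> vspace ?Q" using pv(3) by (simp add: body_iff)
  have "i \<in> index ?Q" if "i \<in> index P - J" "conormal P i \<bullet> (p + v) = supp P i" for i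
  proof -
    have "p + v \<in> face P (insert i J)" using that pv by (simp add: face_iff)
    then show ?thesis using that by (auto simp: index_face_presentation)
  qed
  moreover have "index ?Q \<subseteq> index P - J" by (auto simp: index_face_presentation)
  ultimately show "facets_at ?Q v = facets_at P (p + v) - J"
    using conormal_face_presentation_inner[OF T vU]
    by (auto simp: facets_at_iff[OF pv(2)] facets_at_iff[OF pv(3)] p(2) inner_add_right algebra_simps)
qed

lemma simple_face_presentation:
  fixes P :: "('i, 'a::euclidean_space) presentation"
  assumes P: "is_simple P" and J: "J \<subseteq> index P" and ne: "face P J \<noteq> {}"
  shows "is_simple (face_presentation P J)"
proof -
  let ?Q = "face_presentation P J"
  have pol: "is_polytope P" and T: "subspace (vspace P)" and fin: "finite (index P)"
    and bd: "bounded (body P)"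
    using P by (auto simp: is_simple_def is_polytope_def)
  obtain p where p: "p \<in> face P J" "\<And>i. supp ?Q i = supp P i - conormal P i \<bullet> p"
    by (rule supp_face_presentation[OF ne]) blast
  note bodyQ = body_face_presentation[OF T fin p]
  note U = subspace_face_presentation[OF T, of J]
  note inn = conormal_face_presentation_inner[OF T]
  have diffU: "x - p \<in> vspace ?Q" if "x \<in> face P J" for x
  proof -
    have "x - p \<in> body ?Q" using that by (simp add: bodyQ)
    then show ?thesis by (simp add: body_iff)
  qed
  have shift: "conormal ?Q i \<bullet> (x - p) = supp ?Q i - (supp P i - conormal P i \<bullet> x)"
    if "x \<in> face P J" for x i
    using inn[OF diffU[OF that]] by (simp add: p(2) inner_diff_right)
  obtain y where y: "y \<in> face P J" "\<And>i. i \<in> index P - J \<Longrightarrow> conormal P i \<bullet> y < supp P i"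
    by (rule simple_face_relint[OF P J ne]) blast
  have fac: "\<exists>z\<in>face P J. conormal P i \<bullet> z = supp P i \<and>
      (\<forall>j\<in>index ?Q - {i}. conormal P j \<bullet> z < supp P j)" if i: "i \<in> index ?Q" for i
  proof -
    have "insert i J \<subseteq> index P" "face P (insert i J) \<noteq> {}"
      using i J by (auto simp: index_face_presentation)
    then obtain z where z: "z \<in> face P (insert i J)"
        "\<And>j. j \<in> index P - insert i J \<Longrightarrow> conormal P j \<bullet> z < supp P j"
      using simple_face_relint[OF P] by metis
    then show ?thesis by (intro bexI[of _ z]) (auto simp: face_iff index_face_presentation)
  qed
  have "is_polytope ?Q"
  proof (rule is_polytopeI[OF U])
    show "finite (index ?Q)" using fin by (simp add: index_face_presentation)
    have "body ?Q \<subseteq> (+) (-p) ` body P"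
    proof
      fix x assume "x \<in> body ?Q"
      then have "p + x \<in> body P" by (simp add: bodyQ face_iff)
      then show "x \<in> (+) (-p) ` body P" by (intro image_eqI[of _ _ "p + x"]) simp_all
    qed
    then show "bounded (body ?Q)" using bounded_translation[OF bd] bounded_subset by blast
    show "\<exists>x\<in>vspace ?Q. \<forall>i\<in>index ?Q. conormal ?Q i \<bullet> x < supp ?Q i"
      using y diffU[OF y(1)]
      by (intro bexI[of _ "y - p"]) (auto simp: shift[OF y(1)] index_face_presentation)
    fix i assume i: "i \<in> index ?Q"
    obtain z where z: "z \<in> face P J" "conormal P i \<bullet> z = supp P i"
        "\<forall>j\<in>index ?Q - {i}. conormal P j \<bullet> z < supp P j"
      using fac[OF i] by blast
    show "\<exists>x\<in>vspace ?Q. conormal ?Q i \<bullet> x = supp ?Q i \<and>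
        (\<forall>j\<in>index ?Q - {i}. conormal ?Q j \<bullet> x < supp ?Q j)"
      using z diffU[OF z(1)] by (intro bexI[of _ "z - p"]) (auto simp: shift[OF z(1)])
    have "conormal ?Q i \<bullet> (y - p) < conormal ?Q i \<bullet> (z - p)"
      using y(2)[of i] z(2) i by (simp add: shift[OF z(1)] shift[OF y(1)] index_face_presentation)
    then have "conormal ?Q i \<noteq> 0" by auto
    then show "conormal ?Q i \<in> vspace ?Q \<and> conormal ?Q i \<noteq> 0"
      using riesz_inner(1)[OF U] by (simp add: conormal_face_presentation)
  qed
  moreover have "card (facets_at ?Q v) = dim (vspace ?Q)" if v: "v extreme_point_of body ?Q" for v
  proof -
    note e = extreme_point_face_presentation[OF pol J p v]
    show ?thesis
      using annihilator_basis(1)[OF simple_vertex_basis(5,1-3)[OF P e(1)] e(2)] e(3)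
      by (simp add: vspace_face_presentation)
  qed
  ultimately show ?thesis by (simp add: is_simple_def)
qed

lemma smooth_face_presentation:
  fixes P :: "('i, 'a::euclidean_space) presentation"
  assumes P: "is_smooth P L" and J: "J \<subseteq> index P" and ne: "face P J \<noteq> {}"
  defines "Q \<equiv> face_presentation P J"
  shows "is_smooth Q ((\<lambda>v. riesz (vspace Q) (\<lambda>x. v \<bullet> x)) ` L)"
proof -
  let ?LQ = "(\<lambda>v. riesz (vspace Q) (\<lambda>x. v \<bullet> x)) ` L"
  have sim: "is_simple P" and pol: "is_polytope P"
    using P by (auto simp: is_smooth_def is_simple_def)
  have simQ: "is_simple Q" unfolding Q_def by (rule simple_face_presentation[OF sim J ne])
  then have polQ: "is_polytope Q" by (simp add: is_simple_def)
  obtain p where p: "p \<in> face P J" "\<And>i. supp Q i = supp P i - conormal P i \<bullet> p"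
    unfolding Q_def by (rule supp_face_presentation[OF ne]) blast
  have basis: "is_lattice_basis (vspace Q) ?LQ (conormal Q ` facets_at Q v)"
    if v: "v extreme_point_of body Q" for v
  proof -
    note e = extreme_point_face_presentation[OF pol J p[unfolded Q_def] v[unfolded Q_def]]
    have L: "L = int_span (conormal P ` facets_at P (p + v))"
      using P e(1) by (simp add: is_smooth_def is_lattice_basis_def)
    note ab = annihilator_basis[OF simple_vertex_basis(5,1-3)[OF sim e(1)] e(2),
        folded vspace_face_presentation conormal_face_presentation, folded Q_def]
    have "conormal Q ` facets_at Q v =
        (\<lambda>i. conormal Q i) ` (facets_at P (p + v) - J)"
      using e(3) by (simp add: Q_def)
    then show ?thesis using ab(2-4) unfolding is_lattice_basis_def L by simp
  qed
  have ne0: "face Q {} \<noteq> {}"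
  proof -
    have "0 \<in> body Q"
      using body_face_presentation[OF _ _ p[unfolded Q_def], of 0] pol p(1)
      by (simp add: Q_def is_polytope_def)
    then show ?thesis by (auto simp: face_iff)
  qed
  obtain v where v: "v extreme_point_of body Q"
    using nonempty_face_vertex[OF polQ _ ne0] by blast
  have "primitive ?LQ (conormal Q i)" if i: "i \<in> index Q" for i
  proof -
    have "facet Q i \<noteq> {}" by (rule polytope_facet_nonempty[OF polQ i])
    then obtain w where w: "w extreme_point_of body Q" "{i} \<subseteq> facets_at Q w"
      using nonempty_face_vertex[OF polQ, of "{i}"] i by (auto simp: face_singleton)
    show ?thesis by (rule lattice_basis_primitive[OF basis[OF w(1)]]) (use w(2) in blast)
  qed
  then show ?thesis using simQ basis v by (auto simp: is_smooth_def is_lattice_def)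
qed

lemma simple_or_smooth_face_presentation:
  fixes P :: "('i, 'a::euclidean_space) presentation"
  assumes "is_simple_or_smooth P" "J \<subseteq> index P" "face P J \<noteq> {}"
  shows "is_simple_or_smooth (face_presentation P J)"
  using assms(1) smooth_face_presentation[OF _ assms(2,3)] simple_face_presentation[OF _ assms(2,3)]
  by (auto simp: is_simple_or_smooth_def vlattice_face_presentation split: option.splits)

section \<open>The standard simplex\<close>

text \<open>The simplex in the span of the linearly independent vectors \<open>h j\<close>, \<open>j \<in> J\<close>, given by
  \<open>h j \<bullet> x \<le> 0\<close> for all \<open>j\<close> and \<open>-\<Sum>\<^sub>j h j \<bullet> x \<le> 1\<close>; the last facet has the index \<open>n\<close>.\<close>

definition standard_simplex ::
  "('i \<Rightarrow> 'a::euclidean_space) \<Rightarrow> 'i set \<Rightarrow> 'i \<Rightarrow> 'a set option \<Rightarrow> ('i, 'a) presentation" where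
  "standard_simplex h J n l =
     \<lparr>vspace = span (h ` J), vlattice = l, index = insert n J,
      conormal = (\<lambda>i. if i = n then - (\<Sum>j\<in>J. h j) else h i),
      supp = (\<lambda>i. if i = n then 1 else 0)\<rparr>"

context
  fixes h :: "'i \<Rightarrow> 'a::euclidean_space" and J :: "'i set" and n :: 'i
  assumes J: "finite J" "n \<notin> J" and h: "inj_on h J" "independent (h ` J)"
begin

lemma standard_simplex_sel:
  "vspace (standard_simplex h J n l) = span (h ` J)"
  "vlattice (standard_simplex h J n l) = l"
  "index (standard_simplex h J n l) = insert n J"
  "conormal (standard_simplex h J n l) n = - (\<Sum>j\<in>J. h j)"
  "supp (standard_simplex h J n l) n = 1"
  "j \<in> J \<Longrightarrow> conormal (standard_simplex h J n l) j = h j"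
  "j \<in> J \<Longrightarrow> supp (standard_simplex h J n l) j = 0"
  using J(2) by (auto simp: standard_simplex_def)

lemma standard_simplex_coordinates:
  obtains x where "x \<in> span (h ` J)" "\<And>j. j \<in> J \<Longrightarrow> h j \<bullet> x = c j"
    "(\<Sum>j\<in>J. h j) \<bullet> x = (\<Sum>j\<in>J. c j)"
proof -
  obtain x where "x \<in> span (h ` J)" "\<And>j. j \<in> J \<Longrightarrow> h j \<bullet> x = c j"
    using basis_solve[OF h refl, of c] by blast
  then show ?thesis using that by (simp add: inner_sum_left)
qed

lemma standard_simplex_body:
  "x \<in> body (standard_simplex h J n l) \<longleftrightarrow>
     x \<in> span (h ` J) \<and> (\<forall>j\<in>J. h j \<bullet> x \<le> 0) \<and> - 1 \<le> (\<Sum>j\<in>J. h j) \<bullet> x"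
  by (auto simp: body_iff standard_simplex_sel inner_minus_left)

lemma standard_simplex_face_nonempty:
  assumes K: "K \<subseteq> insert n J"
  shows "face (standard_simplex h J n l) K \<noteq> {} \<longleftrightarrow> K \<noteq> insert n J"
proof
  assume "face (standard_simplex h J n l) K \<noteq> {}"
  then obtain x where x: "x \<in> face (standard_simplex h J n l) K" by blast
  show "K \<noteq> insert n J"
  proof
    assume "K = insert n J"
    then have "h j \<bullet> x = 0" if "j \<in> J" for j
      using x that by (auto simp: face_iff standard_simplex_sel)
    moreover have "- ((\<Sum>j\<in>J. h j) \<bullet> x) = 1"
      using x \<open>K = insert n J\<close> by (simp add: face_iff standard_simplex_sel)
    ultimately show False by (simp add: inner_sum_left)
  qed
next
  assume "K \<noteq> insert n J"
  then obtain l0 where l0: "l0 \<in> insert n J" "l0 \<notin> K" using K by blast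
  \<comment> \<open>The vertex opposite to a facet \<open>l0\<close> outside \<open>K\<close>; for \<open>l0 = n\<close> it is the origin.\<close>
  define c where "c j = (if j = l0 then - 1 else 0 :: real)" for j
  obtain x where x: "x \<in> span (h ` J)" "\<And>j. j \<in> J \<Longrightarrow> h j \<bullet> x = c j"
    "(\<Sum>j\<in>J. h j) \<bullet> x = (\<Sum>j\<in>J. c j)"
    by (rule standard_simplex_coordinates[of c]) blast
  have s: "(\<Sum>j\<in>J. c j) = (if l0 \<in> J then - 1 else 0)" using J(1) by (simp add: c_def)
  have "x \<in> body (standard_simplex h J n l)"
    using x s by (auto simp: standard_simplex_body c_def)
  moreover have "conormal (standard_simplex h J n l) i \<bullet> x = supp (standard_simplex h J n l) i"
    if i: "i \<in> K" for i
  proof (cases "i = n")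
    case True
    then have "l0 \<in> J" using l0 i by blast
    then show ?thesis using x(3) s True by (simp add: standard_simplex_sel)
  next
    case False
    then have "i \<in> J" "i \<noteq> l0" using i K l0 by auto
    then show ?thesis using x(2) by (simp add: standard_simplex_sel c_def)
  qed
  ultimately have "x \<in> face (standard_simplex h J n l) K" by (simp add: face_iff)
  then show "face (standard_simplex h J n l) K \<noteq> {}" by blast
qed

lemma standard_simplex_bounded: "bounded (body (standard_simplex h J n l))"
proof -
  have "\<forall>i. \<exists>x. x \<in> span (h ` J) \<and> (\<forall>j\<in>J. h j \<bullet> x = (if j = i then 1 else 0))"
  proof
    fix i
    show "\<exists>x. x \<in> span (h ` J) \<and> (\<forall>j\<in>J. h j \<bullet> x = (if j = i then 1 else 0))"
      by (rule basis_solve[OF h refl, of "\<lambda>j. if j = i then 1 else 0"]) blast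
  qed
  then obtain d where d: "\<And>i. d i \<in> span (h ` J)"
    "\<And>i j. j \<in> J \<Longrightarrow> h j \<bullet> d i = (if j = i then 1 else 0)" by metis
  have "norm x \<le> (\<Sum>j\<in>J. norm (d j))" if x: "x \<in> body (standard_simplex h J n l)" for x
  proof -
    have xb: "x \<in> span (h ` J)" "\<And>j. j \<in> J \<Longrightarrow> h j \<bullet> x \<le> 0" "- 1 \<le> (\<Sum>j\<in>J. h j \<bullet> x)"
      using x by (auto simp: standard_simplex_body inner_sum_left)
    have "x - (\<Sum>i\<in>J. (h i \<bullet> x) *\<^sub>R d i) = 0"
    proof (rule spanning_inner_zeroI[OF refl])
      show "x - (\<Sum>i\<in>J. (h i \<bullet> x) *\<^sub>R d i) \<in> span (h ` J)"
        using xb(1) d(1) by (intro span_diff span_sum span_scale)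
      fix b assume "b \<in> h ` J"
      then obtain j where j: "j \<in> J" "b = h j" by blast
      have "(\<Sum>i\<in>J. (h i \<bullet> x) * (h j \<bullet> d i)) = (\<Sum>i\<in>J. if j = i then h i \<bullet> x else 0)"
        by (rule sum.cong) (use d(2)[OF j(1)] in auto)
      also have "\<dots> = h j \<bullet> x" using J(1) j(1) by simp
      finally show "b \<bullet> (x - (\<Sum>i\<in>J. (h i \<bullet> x) *\<^sub>R d i)) = 0"
        by (simp add: j inner_diff_right inner_sum_right)
    qed
    then have "norm x = norm (\<Sum>i\<in>J. (h i \<bullet> x) *\<^sub>R d i)" by simp
    also have "\<dots> \<le> (\<Sum>i\<in>J. norm ((h i \<bullet> x) *\<^sub>R d i))" by (rule norm_sum)
    also have "\<dots> \<le> (\<Sum>i\<in>J. norm (d i))"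
    proof (rule sum_mono)
      fix i assume i: "i \<in> J"
      have "(\<Sum>j\<in>J. h j \<bullet> x) = h i \<bullet> x + (\<Sum>j\<in>J - {i}. h j \<bullet> x)"
        by (rule sum.remove[OF J(1) i])
      moreover have "(\<Sum>j\<in>J - {i}. h j \<bullet> x) \<le> 0" by (rule sum_nonpos) (use xb(2) in auto)
      ultimately have "\<bar>h i \<bullet> x\<bar> \<le> 1" using xb(2)[OF i] xb(3) by linarith
      then show "norm ((h i \<bullet> x) *\<^sub>R d i) \<le> norm (d i)" by (simp add: mult_left_le_one_le)
    qed
    finally show ?thesis .
  qed
  then show ?thesis by (auto simp: bounded_iff)
qed

lemma standard_simplex_vertex:
  assumes v: "v extreme_point_of body (standard_simplex h J n l)"
  shows "card (facets_at (standard_simplex h J n l) v) = card J"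
    "span (conormal (standard_simplex h J n l) ` facets_at (standard_simplex h J n l) v) = span (h ` J)"
    "\<exists>i\<in>insert n J. facets_at (standard_simplex h J n l) v = insert n J - {i}"
proof -
  let ?R = "standard_simplex h J n l"
  let ?A = "facets_at ?R v"
  have con: "conormal ?R i \<in> span (h ` J)" if "i \<in> insert n J" for i
    using that by (auto simp: standard_simplex_def span_neg span_sum span_base)
  show sp: "span (conormal ?R ` ?A) = span (h ` J)"
    using extreme_point_span[OF _ _ _ v] con J(1) by (simp add: standard_simplex_sel)
  have A: "?A \<subseteq> insert n J" by (auto simp: facets_at_def standard_simplex_sel)
  then have fin: "finite ?A" using J(1) finite_subset by blast
  have "v \<in> face ?R ?A" using v by (auto simp: extreme_point_of_def face_def facets_at_def)
  then have "?A \<noteq> insert n J" using standard_simplex_face_nonempty[OF A] by blast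
  then have "card ?A < card (insert n J)" using A J(1) by (intro psubset_card_mono) auto
  then have le: "card ?A \<le> card J" using J by simp
  have "card J = dim (span (h ` J))" using h by (simp add: dim_eq_card_independent card_image)
  also have "\<dots> \<le> card (conormal ?R ` ?A)"
    using dim_le_card[of "span (h ` J)" "conormal ?R ` ?A"] sp fin by simp
  also have "\<dots> \<le> card ?A" by (rule card_image_le[OF fin])
  finally show c: "card ?A = card J" using le by simp
  obtain i where i: "i \<in> insert n J" "i \<notin> ?A" using A \<open>?A \<noteq> insert n J\<close> by blast
  have "?A = insert n J - {i}"
    by (rule card_subset_eq) (use J A i c in \<open>auto simp: card_Diff_singleton_if\<close>)
  then show "\<exists>i\<in>insert n J. ?A = insert n J - {i}" using i by blast
qed

lemma simple_standard_simplex: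
  assumes ne: "J \<noteq> {}"
  shows "is_simple (standard_simplex h J n l)"
proof -
  let ?R = "standard_simplex h J n l"
  have strict: "\<exists>x\<in>span (h ` J). (\<forall>j\<in>J. h j \<bullet> x = c j) \<and> (\<Sum>j\<in>J. h j) \<bullet> x = (\<Sum>j\<in>J. c j)" for c
    using standard_simplex_coordinates by metis
  define r where "r = 1 / (real (card J) + 1)"
  have r: "r > 0" "card J * r < 1" by (auto simp: r_def)
  have "is_polytope ?R"
  proof (rule is_polytopeI)
    show "subspace (vspace ?R)" "finite (index ?R)"
      using J by (auto simp: standard_simplex_sel)
    show "bounded (body ?R)" by (rule standard_simplex_bounded)
    obtain x where x: "x \<in> span (h ` J)" "\<And>j. j \<in> J \<Longrightarrow> h j \<bullet> x = - r"
      "(\<Sum>j\<in>J. h j) \<bullet> x = (\<Sum>j\<in>J. - r)" using strict[of "\<lambda>_. - r"] by blast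
    show "\<exists>x\<in>vspace ?R. \<forall>i\<in>index ?R. conormal ?R i \<bullet> x < supp ?R i"
      using x r by (intro bexI[of _ x]) (auto simp: standard_simplex_sel sum_negf)
    fix i assume i: "i \<in> index ?R"
    define c where "c = (\<lambda>j. if i = n then - 1 / real (card J) else if j = i then 0 else - r)"
    obtain y where y: "y \<in> span (h ` J)" "\<And>j. j \<in> J \<Longrightarrow> h j \<bullet> y = c j"
      "(\<Sum>j\<in>J. h j) \<bullet> y = (\<Sum>j\<in>J. c j)" using strict[of c] by blast
    have cJ: "card J > 0" using ne J by (simp add: card_gt_0_iff)
    have sn: "(\<Sum>j\<in>J. c j) = -1" if "i = n" using that cJ by (simp add: c_def)
    have sj: "(\<Sum>j\<in>J. c j) > -1" if "i \<noteq> n"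
    proof -
      have "(\<Sum>j\<in>J. - r) \<le> (\<Sum>j\<in>J. c j)" by (rule sum_mono) (use that r in \<open>simp add: c_def\<close>)
      then show ?thesis using r by simp
    qed
    have "conormal ?R i \<bullet> y = supp ?R i"
      using i y sn by (cases "i = n") (auto simp: standard_simplex_sel c_def)
    moreover have "conormal ?R j \<bullet> y < supp ?R j" if "j \<in> index ?R - {i}" for j
      using that i y sj cJ r by (cases "j = n") (auto simp: standard_simplex_sel c_def)
    ultimately show "\<exists>x\<in>vspace ?R. conormal ?R i \<bullet> x = supp ?R i \<and>
        (\<forall>j\<in>index ?R - {i}. conormal ?R j \<bullet> x < supp ?R j)"
      using y(1) by (intro bexI[of _ y]) (auto simp: standard_simplex_sel)
    have "conormal ?R i \<bullet> x \<noteq> 0"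
      using i x r cJ by (cases "i = n") (auto simp: standard_simplex_sel)
    moreover have "conormal ?R i \<in> span (h ` J)"
      using i by (auto simp: standard_simplex_def span_neg span_sum span_base)
    ultimately show "conormal ?R i \<in> vspace ?R \<and> conormal ?R i \<noteq> 0"
      by (auto simp: standard_simplex_sel)
  qed
  moreover have "dim (vspace ?R) = card J"
    using h by (simp add: standard_simplex_sel dim_eq_card_independent card_image)
  ultimately show ?thesis using standard_simplex_vertex(1) by (simp add: is_simple_def)
qed

text \<open>At a vertex all facets except one are active; the sum of all conormals is zero, so the
  missing conormal is an integer combination of the active ones.\<close>

lemma smooth_standard_simplex:
  assumes ne: "J \<noteq> {}"
  shows "is_smooth (standard_simplex h J n l) (int_span (h ` J))"
proof -
  let ?R = "standard_simplex h J n l" and ?L = "int_span (h ` J)"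
  have simR: "is_simple ?R" by (rule simple_standard_simplex[OF ne])
  have lat: "is_lattice_basis (span (h ` J)) ?L (h ` J)" using h by (simp add: is_lattice_basis_def)
  have hL: "h j \<in> ?L" if "j \<in> J" for j using that J(1) by (auto intro: int_span_base)
  have sumL: "(\<Sum>j\<in>K. h j) \<in> ?L" if "K \<subseteq> J" for K
    using int_span_sum[of K h "h ` J" "\<lambda>_. 1"] hL that by auto
  have conL: "conormal ?R i \<in> ?L" if "i \<in> insert n J" for i
    using that hL int_span_diff[OF int_span_zero sumL[OF subset_refl]]
    by (auto simp: standard_simplex_def)
  have basis: "is_lattice_basis (span (h ` J)) ?L (conormal ?R ` facets_at ?R v)"
    if v: "v extreme_point_of body ?R" for v
  proof -
    note b = simple_vertex_basis[OF simR v]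
    obtain i where i: "i \<in> insert n J" "facets_at ?R v = insert n J - {i}"
      using standard_simplex_vertex(3)[OF v] by blast
    let ?S = "int_span (conormal ?R ` facets_at ?R v)"
    have base: "conormal ?R j \<in> ?S" if "j \<in> insert n J" "j \<noteq> i" for j
      using that i(2) b(5) by (intro int_span_base) auto
    have hS: "h j \<in> ?S" if j: "j \<in> J" for j
    proof (cases "j = i")
      case False
      then show ?thesis using base[of j] j by (simp add: standard_simplex_sel)
    next
      case True
      have "(\<Sum>k\<in>J - {j}. real_of_int 1 *\<^sub>R h k) \<in> ?S"
        using base True by (intro int_span_sum) (force simp: standard_simplex_sel)
      moreover have "- (\<Sum>k\<in>J. h k) \<in> ?S"
        using base[of n] True j J(2) by (auto simp: standard_simplex_sel)
      ultimately have "0 - (- (\<Sum>k\<in>J. h k)) - (\<Sum>k\<in>J - {j}. h k) \<in> ?S"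
        by (intro int_span_diff int_span_zero) simp_all
      then show ?thesis by (simp add: sum.remove[OF J(1) j])
    qed
    have "?S \<subseteq> ?L" using conL i(2) by (intro int_span_minimal) auto
    moreover have "?L \<subseteq> ?S" using hS by (intro int_span_minimal) auto
    ultimately show ?thesis using b(2,3) by (simp add: is_lattice_basis_def standard_simplex_sel)
  qed
  have "primitive ?L (conormal ?R i)" if i: "i \<in> insert n J" for i
  proof -
    have pol: "is_polytope ?R" using simR by (simp add: is_simple_def)
    have "{i} \<noteq> insert n J" using ne J(2) by auto
    then have "face ?R {i} \<noteq> {}" using standard_simplex_face_nonempty[of "{i}"] i by simp
    then obtain v where v: "v extreme_point_of body ?R" "{i} \<subseteq> facets_at ?R v"
      using nonempty_face_vertex[OF pol, of "{i}"] i by (auto simp: standard_simplex_sel)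
    show ?thesis by (rule lattice_basis_primitive[OF basis[OF v(1)]]) (use v(2) in blast)
  qed
  then show ?thesis
    using simR basis lat by (auto simp: is_smooth_def is_lattice_def standard_simplex_sel)
qed

lemma is_simplex_standard_simplex:
  assumes "J \<noteq> {}" "l = None \<or> l = Some (int_span (h ` J))"
  shows "is_simplex (card J) (standard_simplex h J n l)"
proof -
  have "is_simple_or_smooth (standard_simplex h J n l)"
    using assms simple_standard_simplex smooth_standard_simplex
    by (auto simp: is_simple_or_smooth_def standard_simplex_sel)
  then show ?thesis
    using J h by (simp add: is_simplex_def standard_simplex_sel dim_eq_card_independent card_image)
qed

end

section \<open>The splitting induced by a class of equivalent facets\<close>

lemma self_in_conormal_choices: "P \<in> conormal_choices P"
proof (cases "vlattice P")
  case None
  have "P = P\<lparr>conormal := (\<lambda>i. 1 *\<^sub>R conormal P i), supp := (\<lambda>i. 1 * supp P i)\<rparr>" by simp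
  then show ?thesis
    unfolding conormal_choices_def None option.case
    by (intro CollectI exI[of _ "\<lambda>_. 1"]) simp
qed (simp add: conormal_choices_def)

text \<open>A set \<open>I\<close> of facets with a distinguished member \<open>n\<close> and vectors \<open>\<xi> j\<close> that separate
  \<open>n\<close> from each other member \<open>j\<close>. Only these vectors, not the symmetries that produce
  them, matter for the structure of the polytope.\<close>

locale separated_facets =
  fixes P :: "('i, 'a::euclidean_space) presentation" and I :: "'i set" and n :: 'i
    and \<xi> :: "'i \<Rightarrow> 'a"
  assumes simple_or_smooth: "is_simple_or_smooth P"
    and I_index: "I \<subseteq> index P" and n_I: "n \<in> I"
    and xi_vspace: "j \<in> I - {n} \<Longrightarrow> \<xi> j \<in> vspace P"
    and xi: "j \<in> I - {n} \<Longrightarrow> m \<in> index P \<Longrightarrow>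
      conormal P m \<bullet> \<xi> j = (if m = j then 1 else if m = n then -1 else 0)"
begin

text \<open>The projection of the space onto the span of the conormals of \<open>I - {n}\<close> along the common kernel of
  the \<open>\<xi> j\<close>; it becomes the projection to the base of the bundle.\<close>

definition base_part :: "'a \<Rightarrow> 'a" where
  "base_part v = (\<Sum>j\<in>I - {n}. (v \<bullet> \<xi> j) *\<^sub>R conormal P j)"

text \<open>The complementary projection. Restricted to the space of the face \<open>I - {n}\<close>, it becomes the
  embedding of that space for the bundle as well as for the expansion.\<close>

definition fibre_part :: "'a \<Rightarrow> 'a" where
  "fibre_part v = v - base_part v"

abbreviation Q :: "('i, 'a) presentation" where
  "Q \<equiv> face_presentation P (I - {n})"

text \<open>The class of \<open>v\<close> in the quotient by the span of the conormals of \<open>I - {n}\<close>, represented in the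
  space of the face.\<close>

abbreviation res :: "'a \<Rightarrow> 'a" where
  "res v \<equiv> riesz (vspace Q) (\<lambda>x. v \<bullet> x)"

lemma simple_P: "is_simple P"
  using simple_or_smooth by (auto simp: is_simple_or_smooth_def is_smooth_def split: option.splits)

lemma polytope_P: "is_polytope P" using simple_P by (simp add: is_simple_def)

lemma subspace_P: "subspace (vspace P)" and finite_index: "finite (index P)"
  and conormal_P: "i \<in> index P \<Longrightarrow> conormal P i \<in> vspace P"
  using polytope_P by (auto simp: is_polytope_def)

lemma finite_I': "finite (I - {n})" using I_index finite_index finite_subset by blast

lemma linear_base_part: "linear base_part"
  unfolding base_part_def
  by (rule linearI)
    (simp_all add: inner_add_left scaleR_add_left sum.distrib scaleR_sum_right)

lemma linear_fibre_part: "linear fibre_part"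
  unfolding fibre_part_def by (rule linear_compose_sub[OF linear_id[unfolded id_def] linear_base_part])

lemma base_part_vspace: "base_part v \<in> vspace P"
  unfolding base_part_def
  by (intro subspace_sum subspace_scale subspace_P conormal_P) (use I_index in blast)

lemma fibre_part_vspace: "v \<in> vspace P \<Longrightarrow> fibre_part v \<in> vspace P"
  unfolding fibre_part_def by (intro subspace_diff subspace_P base_part_vspace)

lemma base_part_inner_xi:
  assumes j: "j \<in> I - {n}"
  shows "base_part v \<bullet> \<xi> j = v \<bullet> \<xi> j"
proof -
  have "base_part v \<bullet> \<xi> j = (\<Sum>i\<in>I - {n}. if i = j then v \<bullet> \<xi> j else 0)"
    unfolding base_part_def inner_sum_left
    by (rule sum.cong) (use xi[OF j] I_index in auto)
  then show ?thesis using j finite_I' by simp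
qed

lemma fibre_part_inner_xi: "j \<in> I - {n} \<Longrightarrow> fibre_part v \<bullet> \<xi> j = 0"
  by (simp add: fibre_part_def inner_diff_left base_part_inner_xi)

lemma base_part_conormal: "j \<in> I - {n} \<Longrightarrow> base_part (conormal P j) = conormal P j"
proof -
  assume j: "j \<in> I - {n}"
  have "base_part (conormal P j) = (\<Sum>i\<in>I - {n}. if i = j then conormal P j else 0)"
    unfolding base_part_def by (rule sum.cong) (use xi j I_index in auto)
  then show ?thesis using j finite_I' by simp
qed

lemma base_part_conormal_n: "base_part (conormal P n) = - (\<Sum>j\<in>I - {n}. conormal P j)"
proof -
  have "base_part (conormal P n) = (\<Sum>i\<in>I - {n}. - conormal P i)"
    unfolding base_part_def by (rule sum.cong) (use xi I_index n_I in auto)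
  then show ?thesis by (simp add: sum_negf)
qed

lemma base_part_conormal_other: "m \<in> index P - I \<Longrightarrow> base_part (conormal P m) = 0"
  unfolding base_part_def by (rule sum.neutral) (use xi n_I in auto)

lemma base_part_fibre_part: "base_part (fibre_part v) = 0"
  by (simp add: base_part_def fibre_part_inner_xi)

lemma base_part_span: "w \<in> span (conormal P ` (I - {n})) \<Longrightarrow> base_part w = w"
  using linear_eq_on_span[OF linear_base_part linear_id[unfolded id_def]] base_part_conormal
  by (metis (no_types, lifting) imageE)

lemma base_part_in_span: "base_part v \<in> span (conormal P ` (I - {n}))"
  unfolding base_part_def by (intro span_sum span_scale span_base imageI)

lemma subspace_Q: "subspace (vspace Q)" by (rule subspace_face_presentation[OF subspace_P])

lemma res_vspace: "res v \<in> vspace Q" by (rule riesz_inner(1)[OF subspace_Q])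

lemma vspace_Q_subset: "vspace Q \<subseteq> vspace P" by (auto simp: vspace_face_presentation)

lemma res_conormal: "j \<in> I - {n} \<Longrightarrow> res (conormal P j) = 0"
  by (rule riesz_eqI[OF subspace_Q subspace_0[OF subspace_Q]]) (simp add: vspace_face_presentation)

lemma res_base_part: "res (base_part v) = 0"
  unfolding base_part_def linear_sum[OF linear_riesz_inner[OF subspace_Q]]
  by (rule sum.neutral)
    (simp add: linear_cmul[OF linear_riesz_inner[OF subspace_Q]] res_conormal del: Diff_iff)

lemma res_fibre_part: "u \<in> vspace Q \<Longrightarrow> res (fibre_part u) = u"
  unfolding fibre_part_def linear_diff[OF linear_riesz_inner[OF subspace_Q]] res_base_part
  using riesz_inner_id[OF subspace_Q] by simp

text \<open>The projection \<open>fibre_part\<close> kills the span of the conormals of \<open>I - {n}\<close>, hence factors through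
  the quotient map \<open>res\<close>; by \<open>res_fibre_part\<close>, its restriction to the space of the face is a section of
  \<open>res\<close>.\<close>

lemma fibre_part_res:
  assumes v: "v \<in> vspace P"
  shows "fibre_part (res v) = fibre_part v"
proof -
  let ?z = "v - res v"
  have zT: "?z \<in> vspace P"
    using v res_vspace vspace_Q_subset subspace_diff[OF subspace_P] by blast
  have "fibre_part ?z = 0"
  proof (rule subspace_inner_zeroI[OF subspace_P fibre_part_vspace[OF zT]])
    fix x assume x: "x \<in> vspace P"
    define y where "y = x - (\<Sum>j\<in>I - {n}. (conormal P j \<bullet> x) *\<^sub>R \<xi> j)"
    have "conormal P i \<bullet> y = 0" if i: "i \<in> I - {n}" for i
    proof -
      have "(\<Sum>j\<in>I - {n}. (conormal P j \<bullet> x) * (conormal P i \<bullet> \<xi> j)) =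
          (\<Sum>j\<in>I - {n}. if j = i then conormal P i \<bullet> x else 0)"
        by (rule sum.cong) (use xi i I_index in auto)
      then show ?thesis using i finite_I' by (simp add: y_def inner_diff_right inner_sum_right)
    qed
    moreover have "y \<in> vspace P"
      unfolding y_def using x xi_vspace
      by (intro subspace_diff subspace_sum subspace_scale subspace_P) auto
    ultimately have "y \<in> vspace Q" by (simp add: vspace_face_presentation)
    then have "?z \<bullet> y = 0" by (simp add: inner_diff_left riesz_inner(2)[OF subspace_Q])
    moreover have "fibre_part ?z \<bullet> x = ?z \<bullet> y"
      by (simp only: fibre_part_def base_part_def y_def inner_diff_left[of ?z] inner_diff_right
          inner_sum_left inner_sum_right inner_scaleR_left inner_scaleR_right mult.commute)
    ultimately show "fibre_part ?z \<bullet> x = 0" by simp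
  qed
  then show ?thesis using linear_diff[OF linear_fibre_part, of v "res v"] by simp
qed

lemma fibre_part_conormal_Q:
  assumes "i \<in> index P"
  shows "fibre_part (conormal Q i) = fibre_part (conormal P i)"
  unfolding conormal_face_presentation by (rule fibre_part_res[OF conormal_P[OF assms]])

lemma fibre_part_conormal_other: "m \<in> index P - I \<Longrightarrow> fibre_part (conormal P m) = conormal P m"
  by (simp add: fibre_part_def base_part_conormal_other)

lemma fibre_part_image: "fibre_part ` vspace Q = {v \<in> vspace P. base_part v = 0}"
proof (intro subset_antisym subsetI)
  fix v assume "v \<in> {v \<in> vspace P. base_part v = 0}"
  then have "v \<in> vspace P" "v = fibre_part v" by (auto simp: fibre_part_def)
  then show "v \<in> fibre_part ` vspace Q" using fibre_part_res res_vspace by (metis imageI)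
qed (use fibre_part_vspace vspace_Q_subset base_part_fibre_part in auto)

lemma base_part_image: "base_part ` vspace P = span (conormal P ` (I - {n}))"
proof
  show "span (conormal P ` (I - {n})) \<subseteq> base_part ` vspace P"
  proof
    fix w assume w: "w \<in> span (conormal P ` (I - {n}))"
    have "base_part w = w" by (rule base_part_span[OF w])
    then show "w \<in> base_part ` vspace P" using base_part_vspace[of w] by (metis imageI)
  qed
qed (use base_part_in_span in auto)

text \<open>The vectors \<open>\<xi> j\<close> are integral on the lattice because they are integral on the conormals, which
  contain a lattice basis.\<close>

lemma lattice:
  assumes L: "vlattice P = Some L"
  shows "L \<subseteq> vspace P" "i \<in> index P \<Longrightarrow> conormal P i \<in> L"
    "v \<in> L \<Longrightarrow> w \<in> L \<Longrightarrow> v - w \<in> L" "v \<in> L \<Longrightarrow> w \<in> L \<Longrightarrow> v + w \<in> L"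
    "(\<And>i. i \<in> A \<Longrightarrow> g i \<in> L) \<Longrightarrow> (\<And>i. i \<in> A \<Longrightarrow> r i \<in> \<int>) \<Longrightarrow> (\<Sum>i\<in>A. r i *\<^sub>R g i) \<in> L"
    "v \<in> L \<Longrightarrow> j \<in> I - {n} \<Longrightarrow> v \<bullet> \<xi> j \<in> \<int>"
proof -
  have sm: "is_smooth P L" using simple_or_smooth L by (simp add: is_simple_or_smooth_def)
  have "face P {n} \<noteq> {}"
    using polytope_facet_nonempty[OF polytope_P] I_index n_I by (auto simp: face_singleton)
  then obtain v0 where v0: "v0 extreme_point_of body P"
    using nonempty_face_vertex[OF polytope_P, of "{n}"] I_index n_I by blast
  let ?B = "conormal P ` facets_at P v0"
  have B: "span ?B = vspace P" "L = int_span ?B"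
    using sm v0 by (auto simp: is_smooth_def is_lattice_basis_def)
  show "L \<subseteq> vspace P" using int_span_subset_span[of ?B] B by simp
  show "i \<in> index P \<Longrightarrow> conormal P i \<in> L" using sm by (auto simp: is_smooth_def primitive_def)
  show "v \<in> L \<Longrightarrow> w \<in> L \<Longrightarrow> v - w \<in> L" "v \<in> L \<Longrightarrow> w \<in> L \<Longrightarrow> v + w \<in> L"
    unfolding B(2) by (auto intro: int_span_diff int_span_add)
  show "v \<bullet> \<xi> j \<in> \<int>" if "v \<in> L" "j \<in> I - {n}"
  proof (rule int_span_inner_int)
    show "v \<in> int_span ?B" using that B by simp
    show "b \<bullet> \<xi> j \<in> \<int>" if "b \<in> ?B" for b
      using that xi[OF \<open>j \<in> I - {n}\<close>] by (auto simp: facets_at_def)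
  qed
  show "(\<Sum>i\<in>A. r i *\<^sub>R g i) \<in> L" if g: "\<And>i. i \<in> A \<Longrightarrow> g i \<in> L" and r: "\<And>i. i \<in> A \<Longrightarrow> r i \<in> \<int>"
  proof -
    have "\<forall>i\<in>A. \<exists>z. r i = real_of_int z" using r by (auto elim!: Ints_cases)
    then obtain z where "\<And>i. i \<in> A \<Longrightarrow> r i = real_of_int (z i)" by metis
    then have "(\<Sum>i\<in>A. r i *\<^sub>R g i) = (\<Sum>i\<in>A. real_of_int (z i) *\<^sub>R g i)" by simp
    then show ?thesis using g int_span_sum[of A g ?B z] B(2) by simp
  qed
qed

lemma lattice_parts:
  assumes L: "vlattice P = Some L" and v: "v \<in> L"
  shows "base_part v \<in> L" "fibre_part v \<in> L"
    "base_part v \<in> int_span (conormal P ` (I - {n}))"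
proof -
  note l = lattice[OF L]
  show b: "base_part v \<in> L"
    unfolding base_part_def by (rule l(5)) (use l(2,6) v I_index in auto)
  then show "fibre_part v \<in> L" unfolding fibre_part_def using l(3) v by blast
  have "\<forall>j\<in>I - {n}. \<exists>z. v \<bullet> \<xi> j = real_of_int z" using l(6)[OF v] by (auto elim!: Ints_cases)
  then obtain z where z: "\<And>j. j \<in> I - {n} \<Longrightarrow> v \<bullet> \<xi> j = real_of_int (z j)" by metis
  have "base_part v = (\<Sum>j\<in>I - {n}. real_of_int (z j) *\<^sub>R conormal P j)"
    unfolding base_part_def by (rule sum.cong) (use z in auto)
  then show "base_part v \<in> int_span (conormal P ` (I - {n}))"
    using finite_I' by (auto intro!: int_span_sum int_span_base)
qed

text \<open>A motion along the \<open>\<xi> j\<close> brings each point of the body into the face \<open>I - {n}\<close>. It leaves the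
  inequalities outside \<open>I\<close> untouched, and the inequality \<open>n\<close> only gains slack.\<close>

lemma shift_into_face:
  assumes y: "y \<in> body P"
  obtains y' where "y' \<in> face P (I - {n})"
    "\<And>m. m \<in> index P - I \<Longrightarrow> conormal P m \<bullet> y' = conormal P m \<bullet> y"
proof -
  define t where "t j = supp P j - conormal P j \<bullet> y" for j
  define y' where "y' = y + (\<Sum>j\<in>I - {n}. t j *\<^sub>R \<xi> j)"
  have t: "t j \<ge> 0" if "j \<in> I - {n}" for j using y that I_index by (auto simp: t_def body_iff)
  have val: "conormal P m \<bullet> y' = conormal P m \<bullet> y + (\<Sum>j\<in>I - {n}. t j * (conormal P m \<bullet> \<xi> j))" for m
    by (simp add: y'_def inner_add_right inner_sum_right)
  have 1: "conormal P i \<bullet> y' = supp P i" if i: "i \<in> I - {n}" for i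
  proof -
    have "(\<Sum>j\<in>I - {n}. t j * (conormal P i \<bullet> \<xi> j)) = (\<Sum>j\<in>I - {n}. if j = i then t i else 0)"
      by (rule sum.cong) (use xi i I_index in auto)
    then show ?thesis using val[of i] i finite_I' by (simp add: t_def)
  qed
  have 2: "conormal P m \<bullet> y' = conormal P m \<bullet> y" if m: "m \<in> index P - I" for m
  proof -
    have "(\<Sum>j\<in>I - {n}. t j * (conormal P m \<bullet> \<xi> j)) = 0"
      by (rule sum.neutral) (use xi m n_I in auto)
    then show ?thesis using val[of m] by simp
  qed
  have 3: "conormal P n \<bullet> y' \<le> conormal P n \<bullet> y"
  proof -
    have "(\<Sum>j\<in>I - {n}. t j * (conormal P n \<bullet> \<xi> j)) \<le> 0"
      by (rule sum_nonpos) (use xi n_I I_index t in auto)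
    then show ?thesis using val[of n] by simp
  qed
  have "y' \<in> vspace P"
    unfolding y'_def using y xi_vspace
    by (intro subspace_add subspace_sum subspace_scale subspace_P) (auto simp: body_iff)
  moreover have "conormal P m \<bullet> y' \<le> supp P m" if m: "m \<in> index P" for m
  proof -
    have "conormal P m \<bullet> y \<le> supp P m" using y m by (simp add: body_iff)
    then show ?thesis using 1[of m] 2[of m] 3 m by (cases "m \<in> I"; cases "m = n") auto
  qed
  ultimately have "y' \<in> face P (I - {n})" using 1 by (simp add: face_iff body_iff)
  then show ?thesis using that 2 by blast
qed

lemma face_I'_nonempty: "face P (I - {n}) \<noteq> {}"
proof -
  have "facet P n \<noteq> {}" using polytope_facet_nonempty[OF polytope_P] I_index n_I by blast
  then obtain y where "y \<in> body P" by (auto simp: facet_iff)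
  then show ?thesis using shift_into_face by blast
qed

lemma index_Q_other: "index P - I \<subseteq> index Q"
proof
  fix m assume m: "m \<in> index P - I"
  then obtain y where y: "y \<in> facet P m" using polytope_facet_nonempty[OF polytope_P] by blast
  then have "y \<in> body P" by (simp add: facet_iff)
  then obtain y' where "y' \<in> face P (I - {n})" "conormal P m \<bullet> y' = conormal P m \<bullet> y"
    using shift_into_face m by metis
  then have "y' \<in> face P (insert m (I - {n}))" using y by (simp add: face_iff facet_iff)
  then show "m \<in> index Q" using m n_I by (auto simp: index_face_presentation)
qed

lemma index_Q: "index Q = (if face P I = {} then index P - I else insert n (index P - I))"
proof -
  have I: "insert n (I - {n}) = I" using n_I by blast
  have "index Q \<subseteq> insert n (index P - I)" by (auto simp: index_face_presentation)
  moreover have "n \<in> index Q \<longleftrightarrow> face P I \<noteq> {}"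
    using n_I I_index by (auto simp: index_face_presentation I insert_absorb)
  ultimately show ?thesis using index_Q_other n_I by auto
qed

lemma simple_or_smooth_Q: "is_simple_or_smooth Q"
  by (rule simple_or_smooth_face_presentation[OF simple_or_smooth _ face_I'_nonempty]) (use I_index in blast)

lemma conormal_I'_independent:
  "inj_on (conormal P) (I - {n})" "independent (conormal P ` (I - {n}))"
proof -
  obtain v where v: "v extreme_point_of body P" "I - {n} \<subseteq> facets_at P v"
    using nonempty_face_vertex[OF polytope_P _ face_I'_nonempty] I_index by blast
  note b = simple_vertex_basis(1,2)[OF simple_P v(1)]
  show "inj_on (conormal P) (I - {n})" using b(1) v(2) by (rule inj_on_subset)
  show "independent (conormal P ` (I - {n}))" using b(2) v(2) by (meson image_mono independent_mono)
qed

end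

section \<open>Expansion and bundle structure\<close>

lemma face_product_presentation:
  fixes S :: "('j, 'b::euclidean_space) presentation" and R :: "('k, 'c::euclidean_space) presentation"
  shows "face (product_presentation S R) J = face S (Inl -` J) \<times> face R (Inr -` J)"
proof -
  have all: "(\<forall>j\<in>J. A j) \<longleftrightarrow> (\<forall>j\<in>Inl -` J. A (Inl j)) \<and> (\<forall>j\<in>Inr -` J. A (Inr j))"
    for A :: "'j + 'k \<Rightarrow> bool"
  proof (intro iffI ballI)
    fix j assume "(\<forall>j\<in>Inl -` J. A (Inl j)) \<and> (\<forall>j\<in>Inr -` J. A (Inr j))" "j \<in> J"
    then show "A j" by (cases j) auto
  qed auto
  have "body (product_presentation S R) = body S \<times> body R"
    by (auto simp: body_iff product_presentation_def Plus_def ball_Un)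
  moreover have "(\<forall>j\<in>J. conormal (product_presentation S R) j \<bullet> z = supp (product_presentation S R) j)
     \<longleftrightarrow> (\<forall>j\<in>Inl -` J. conormal S j \<bullet> fst z = supp S j) \<and>
       (\<forall>j\<in>Inr -` J. conormal R j \<bullet> snd z = supp R j)" for z
    by (subst all) (simp add: product_presentation_def inner_prod_def)
  ultimately show ?thesis by (auto simp: face_iff)
qed

context separated_facets
begin

lemma expansion_along_facet:
  assumes ne: "face P I \<noteq> {}"
  shows "is_expansion (card I - 1) P Q n I"
proof -
  define k where "k = card I - 1"
  have "card (I - {n}) = k" using n_I by (simp add: k_def)
  then obtain g where g: "bij_betw g {1..k} (I - {n})"
    using ex_bij_betw_nat_finite_1[OF finite_I'] by blast
  have gI: "g i \<in> I - {n}" if "i \<in> {1..k}" for i using g that by (rule bij_betwE[THEN bspec])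
  have sum_g: "(\<Sum>i\<in>{1..k}. F (g i)) = (\<Sum>j\<in>I - {n}. F j)" for F :: "'i \<Rightarrow> 'a"
    by (rule sum.reindex_bij_betw[OF g])
  have xig: "conormal P (g i) \<bullet> \<xi> (g l) = (if i = l then 1 else 0)"
    if "i \<in> {1..k}" "l \<in> {1..k}" for i l
  proof -
    have "g i = g l \<longleftrightarrow> i = l" by (rule inj_on_eq_iff[OF bij_betw_imp_inj_on[OF g] that])
    moreover have "g i \<in> index P" "g i \<noteq> n" using gI[OF that(1)] I_index by auto
    ultimately show ?thesis using xi[OF gI[OF that(2)], of "g i"] by simp
  qed
  obtain p where p: "p \<in> face P (I - {n})" "\<And>i. supp Q i = supp P i - conormal P i \<bullet> p"
    by (rule supp_face_presentation[OF face_I'_nonempty]) blast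
  have pT: "p \<in> vspace P" using p(1) by (simp add: face_iff body_iff)
  define e where "e i = - conormal P (g i)" for i
  have eT: "e i \<in> vspace P" if "i \<in> {1..k}" for i
    unfolding e_def using gI[OF that] I_index by (intro subspace_neg subspace_P conormal_P) auto
  define \<theta> where "\<theta> = (\<lambda>(v, s). fibre_part v + (\<Sum>i\<in>{1..k}. s i *\<^sub>R e i))"
  define \<eta> where "\<eta> i = (if i \<le> k then - e i else fibre_part (conormal Q n) + (\<Sum>i\<in>{1..k}. e i))" for i
  define \<kappa> where "\<kappa> i = (if i \<le> k then 0 else supp Q n)" for i
  \<comment> \<open>The inverse of the identification \<open>\<theta>\<close>.\<close>
  define coords where "coords w = (res w, \<lambda>i\<in>{1..k}. - (w \<bullet> \<xi> (g i)))" for w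
  have nP: "n \<in> index P" using n_I I_index by blast
  have \<eta>: "\<eta> i = conormal P (g i)" if "i \<in> {1..k}" for i using that by (simp add: \<eta>_def e_def)
  have \<eta>n: "\<eta> (k + 1) = conormal P n"
  proof -
    have "\<eta> (k + 1) = fibre_part (conormal Q n) + (\<Sum>j\<in>I - {n}. - conormal P j)"
      using sum_g[of "\<lambda>j. - conormal P j"] by (simp add: \<eta>_def e_def)
    moreover have "fibre_part (conormal Q n) = conormal P n + (\<Sum>j\<in>I - {n}. conormal P j)"
      unfolding fibre_part_conormal_Q[OF nP] unfolding fibre_part_def base_part_conormal_n by simp
    ultimately show ?thesis by (simp add: sum_negf)
  qed
  have \<theta>_coords: "\<theta> (coords w) = w" if w: "w \<in> vspace P" for w
  proof -
    have "(\<Sum>i\<in>{1..k}. (\<lambda>i\<in>{1..k}. - (w \<bullet> \<xi> (g i))) i *\<^sub>R e i) =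
        (\<Sum>i\<in>{1..k}. (w \<bullet> \<xi> (g i)) *\<^sub>R conormal P (g i))"
      by (rule sum.cong) (auto simp: e_def)
    also have "\<dots> = base_part w"
      unfolding base_part_def by (rule sum_g[of "\<lambda>j. (w \<bullet> \<xi> j) *\<^sub>R conormal P j"])
    finally show ?thesis
      by (simp add: \<theta>_def coords_def fibre_part_res[OF w]) (simp add: fibre_part_def)
  qed
  have sumT: "(\<Sum>i\<in>{1..k}. s i *\<^sub>R e i) \<in> vspace P" for s
    by (intro subspace_sum subspace_scale subspace_P eT)
  have \<theta>T: "\<theta> vs \<in> vspace P" if "vs \<in> vspace Q \<times> ({1..k} \<rightarrow>\<^sub>E UNIV)" for vs
    using that fibre_part_vspace vspace_Q_subset subspace_add[OF subspace_P _ sumT]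
    by (auto simp: \<theta>_def)
  have coords_\<theta>: "coords (\<theta> vs) = vs" if vs: "vs \<in> vspace Q \<times> ({1..k} \<rightarrow>\<^sub>E UNIV)" for vs
  proof -
    obtain v s where vs': "vs = (v, s)" "v \<in> vspace Q" "s \<in> {1..k} \<rightarrow>\<^sub>E UNIV" using vs by auto
    have lin: "linear res" by (rule linear_riesz_inner[OF subspace_Q])
    have "res (\<Sum>i\<in>{1..k}. s i *\<^sub>R e i) = 0"
      unfolding linear_sum[OF lin]
    proof (rule sum.neutral, rule ballI)
      fix i assume "i \<in> {1..k}"
      then have "res (e i) = 0"
        unfolding e_def linear_neg[OF lin] using res_conormal[OF gI] by simp
      then show "res (s i *\<^sub>R e i) = 0" unfolding linear_cmul[OF lin] by simp
    qed
    then have 1: "res (\<theta> vs) = v"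
      using vs' by (simp add: \<theta>_def linear_add[OF lin] res_fibre_part)
    have "- (\<theta> vs \<bullet> \<xi> (g l)) = s l" if l: "l \<in> {1..k}" for l
    proof -
      have "(\<Sum>i\<in>{1..k}. s i * (e i \<bullet> \<xi> (g l))) = (\<Sum>i\<in>{1..k}. if i = l then - s l else 0)"
        by (rule sum.cong) (use xig l in \<open>auto simp: e_def\<close>)
      also have "\<dots> = - s l" using l by simp
      finally show ?thesis
        using vs' fibre_part_inner_xi[OF gI[OF l]]
        by (simp add: \<theta>_def inner_add_left inner_sum_left)
    qed
    then have "(\<lambda>i\<in>{1..k}. - (\<theta> vs \<bullet> \<xi> (g i))) = s"
      using vs'(3) by (intro extensionalityI[of _ "{1..k}"]) (auto simp: PiE_def)
    then show ?thesis using 1 vs' by (simp add: coords_def)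
  qed
  have bij: "bij_betw \<theta> (vspace Q \<times> ({1..k} \<rightarrow>\<^sub>E (UNIV :: real set))) (vspace P)"
    by (rule bij_betw_byWitness[where f' = coords])
      (use coords_\<theta> \<theta>_coords \<theta>T res_vspace in \<open>auto simp: coords_def\<close>)
  have latt: "\<theta> ` ((res ` L) \<times> ({1..k} \<rightarrow>\<^sub>E (\<int> :: real set))) = L" if L: "vlattice P = Some L" for L
  proof (intro subset_antisym subsetI)
    note l = lattice[OF L]
    fix w assume "w \<in> \<theta> ` ((res ` L) \<times> ({1..k} \<rightarrow>\<^sub>E (\<int> :: real set)))"
    then obtain v s where vs: "v \<in> L" "s \<in> {1..k} \<rightarrow>\<^sub>E \<int>" "w = \<theta> (res v, s)" by auto
    have vT: "v \<in> vspace P" using vs(1) l(1) by blast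
    have "w = fibre_part v + (\<Sum>i\<in>{1..k}. (- s i) *\<^sub>R conormal P (g i))"
      using vs(3) by (simp add: \<theta>_def fibre_part_res[OF vT] e_def)
    moreover have "(\<Sum>i\<in>{1..k}. (- s i) *\<^sub>R conormal P (g i)) \<in> L"
      by (rule l(5)) (use l(2) gI I_index vs(2) in auto)
    ultimately show "w \<in> L" using lattice_parts(2)[OF L vs(1)] l(4) by simp
  next
    note l = lattice[OF L]
    fix w assume w: "w \<in> L"
    have "coords w \<in> (res ` L) \<times> ({1..k} \<rightarrow>\<^sub>E (\<int> :: real set))"
      using w l(6)[OF w gI] by (auto simp: coords_def)
    moreover have "w = \<theta> (coords w)" using \<theta>_coords w l(1) by auto
    ultimately show "w \<in> \<theta> ` ((res ` L) \<times> ({1..k} \<rightarrow>\<^sub>E (\<int> :: real set)))"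
      by (rule rev_image_eqI)
  qed
  have iQ: "index Q - {n} = index P - I" using index_Q ne n_I by auto
  have shift: "conormal P i \<bullet> x \<le> supp Q i \<longleftrightarrow> conormal P i \<bullet> (x + p) \<le> supp P i" for i x
    by (auto simp: p(2) inner_add_right)
  have sQ: "supp Q j = 0" if "j \<in> I - {n}" for j
    using that p(1) by (simp add: p(2) face_iff)
  have upto: "{1..k + 1} = insert (k + 1) {1..k}" by auto
  have base: "(\<forall>i\<in>{1..k + 1}. \<eta> i \<bullet> x \<le> \<kappa> i) \<longleftrightarrow> (\<forall>j\<in>I. conormal P j \<bullet> x \<le> supp Q j)" for x
  proof -
    have "(\<forall>i\<in>{1..k}. \<eta> i \<bullet> x \<le> \<kappa> i) \<longleftrightarrow> (\<forall>i\<in>{1..k}. conormal P (g i) \<bullet> x \<le> supp Q (g i))"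
      using sQ gI by (simp add: \<eta> \<kappa>_def)
    also have "\<dots> \<longleftrightarrow> (\<forall>j\<in>g ` {1..k}. conormal P j \<bullet> x \<le> supp Q j)" by simp
    also have "g ` {1..k} = I - {n}" using g by (rule bij_betw_imp_surj_on)
    finally show ?thesis using n_I \<eta>n unfolding upto by (auto simp: \<kappa>_def)
  qed
  have body: "(\<lambda>x. x - p) ` body P = {x \<in> vspace P.
      (\<forall>j\<in>index Q - {n}. fibre_part (conormal Q j) \<bullet> x \<le> supp Q j) \<and>
      (\<forall>i\<in>{1..k + 1}. \<eta> i \<bullet> x \<le> \<kappa> i)}" (is "_ = ?rhs")
  proof -
    have rhs: "x \<in> ?rhs \<longleftrightarrow> x \<in> vspace P \<and> (\<forall>i\<in>index P. conormal P i \<bullet> (x + p) \<le> supp P i)" for x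
    proof -
      have "(\<forall>j\<in>index P - I. fibre_part (conormal Q j) \<bullet> x \<le> supp Q j) \<longleftrightarrow>
          (\<forall>j\<in>index P - I. conormal P j \<bullet> x \<le> supp Q j)"
        by (intro ball_cong refl) (simp add: fibre_part_conormal_Q fibre_part_conormal_other)
      then show ?thesis using I_index unfolding iQ base shift by blast
    qed
    show ?thesis
    proof (intro subset_antisym subsetI)
      fix x assume "x \<in> (\<lambda>x. x - p) ` body P"
      then obtain y where "y \<in> body P" "x = y - p" by blast
      then show "x \<in> ?rhs"
        unfolding rhs using subspace_diff[OF subspace_P _ pT] by (auto simp: body_iff)
    next
      fix x assume "x \<in> ?rhs"
      then have "x + p \<in> body P"
        unfolding rhs using subspace_add[OF subspace_P _ pT] by (simp add: body_iff)
      then show "x \<in> (\<lambda>x. x - p) ` body P" by (intro image_eqI[of _ _ "x + p"]) simp_all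
    qed
  qed
  have con: "conormal P ` I = \<eta> ` {1..k + 1}"
  proof -
    have "\<eta> ` {1..k} = (\<lambda>i. conormal P (g i)) ` {1..k}" by (rule image_cong) (auto simp: \<eta>)
    also have "\<dots> = conormal P ` (I - {n})"
      using bij_betw_imp_surj_on[OF g] by (metis image_image)
    finally have "\<eta> ` {1..k + 1} = conormal P ` insert n (I - {n})"
      unfolding upto image_insert \<eta>n by (rule arg_cong)
    then show ?thesis using n_I by (simp add: insert_absorb)
  qed
  have "is_expansion_recorded k P Q n I"
    unfolding is_expansion_recorded_def Let_def
  proof (rule exI[of _ fibre_part], rule exI[of _ e], rule exI[of _ p], intro conjI)
    show "case (vlattice Q, vlattice P) of (None, None) \<Rightarrow> True
        | (Some LQ, Some LP) \<Rightarrow>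
            (\<lambda>(v, s). fibre_part v + (\<Sum>i\<in>{1..k}. s i *\<^sub>R e i)) ` (LQ \<times> ({1..k} \<rightarrow>\<^sub>E \<int>)) = LP
        | _ \<Rightarrow> False"
      using latt by (cases "vlattice P") (simp_all add: vlattice_face_presentation \<theta>_def)
  qed (use linear_fibre_part pT bij body con I_index in \<open>simp_all add: \<theta>_def \<eta>_def \<kappa>_def cong: if_cong\<close>)
  moreover have "n \<in> index Q" using index_Q ne by simp
  ultimately show ?thesis
    unfolding is_expansion_def k_def[symmetric]
    using simple_or_smooth simple_or_smooth_Q self_in_conormal_choices by blast
qed

text \<open>The base of the bundle: the space is the span of the conormals of \<open>I - {n}\<close>, and the
  facets are indexed by \<open>I\<close>.\<close>

definition base_simplex :: "('i, 'a) presentation" where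
  "base_simplex = standard_simplex (conormal P) (I - {n}) n
     (map_option (\<lambda>_. int_span (conormal P ` (I - {n}))) (vlattice P))"

lemma simplex_base_simplex:
  assumes "I \<noteq> {n}"
  shows "is_simplex (card I - 1) base_simplex"
proof -
  have "is_simplex (card (I - {n})) base_simplex"
    unfolding base_simplex_def
    by (rule is_simplex_standard_simplex[OF finite_I' _ conormal_I'_independent])
      (use assms n_I in \<open>auto split: option.splits\<close>)
  then show ?thesis using n_I by simp
qed

lemma base_simplex_sel:
  "vspace base_simplex = span (conormal P ` (I - {n}))"
  "vlattice base_simplex = map_option (\<lambda>_. int_span (conormal P ` (I - {n}))) (vlattice P)"
  "index base_simplex = I"
  using n_I by (auto simp: base_simplex_def standard_simplex_def insert_absorb)

lemma base_part_conormal_simplex: "i \<in> I \<Longrightarrow> base_part (conormal P i) = conormal base_simplex i"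
  by (simp add: base_simplex_def standard_simplex_def base_part_conormal base_part_conormal_n)

lemma face_base_simplex:
  assumes "K \<subseteq> I"
  shows "face base_simplex K \<noteq> {} \<longleftrightarrow> K \<noteq> I"
proof -
  have I: "insert n (I - {n}) = I" using n_I by blast
  show ?thesis
    unfolding base_simplex_def
    using standard_simplex_face_nonempty[OF finite_I' _ conormal_I'_independent, of n K] assms
    by (simp add: I del: insert_Diff_single)
qed

text \<open>From left to right, the point is moved by \<open>shift_into_face\<close>. From right to left, if \<open>n \<in> K\<close>, some
  facet \<open>l \<in> I - {n}\<close> is not required, and a motion along \<open>\<xi> l\<close> leaves \<open>l\<close> and reaches the facet \<open>n\<close>.\<close>

lemma faces_of_bundle:
  assumes empty: "face P I = {}" and J: "J \<subseteq> index P - I" and K: "K \<subseteq> I"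
  shows "face P (J \<union> K) \<noteq> {} \<longleftrightarrow> face P (J \<union> (I - {n})) \<noteq> {} \<and> K \<noteq> I"
proof (intro iffI conjI)
  assume "face P (J \<union> K) \<noteq> {}"
  then obtain y where y: "y \<in> face P (J \<union> K)" by blast
  show "K \<noteq> I"
  proof
    assume "K = I"
    then have "y \<in> face P I" using y by (simp add: face_iff)
    then show False using empty by simp
  qed
  obtain y' where y': "y' \<in> face P (I - {n})"
      "\<And>m. m \<in> index P - I \<Longrightarrow> conormal P m \<bullet> y' = conormal P m \<bullet> y"
    using shift_into_face[of y] y by (auto simp: face_iff)
  have "conormal P j \<bullet> y' = supp P j" if "j \<in> J" for j
  proof -
    have "conormal P j \<bullet> y' = conormal P j \<bullet> y" using y'(2) J that by blast
    then show ?thesis using y that by (simp add: face_iff)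
  qed
  then have "y' \<in> face P (J \<union> (I - {n}))" using y'(1) by (auto simp: face_iff)
  then show "face P (J \<union> (I - {n})) \<noteq> {}" by blast
next
  assume "face P (J \<union> (I - {n})) \<noteq> {} \<and> K \<noteq> I"
  then obtain y where y: "y \<in> face P (J \<union> (I - {n}))" and KI: "K \<noteq> I" by blast
  show "face P (J \<union> K) \<noteq> {}"
  proof (cases "n \<in> K")
    case False
    then have "y \<in> face P (J \<union> K)" using y K by (auto simp: face_iff)
    then show ?thesis by blast
  next
    case True
    then obtain l where l: "l \<in> I - {n}" "l \<notin> K" using KI K by blast
    define s where "s = supp P n - conormal P n \<bullet> y"
    define y' where "y' = y - s *\<^sub>R \<xi> l"
    have yb: "y \<in> body P" using y by (simp add: face_iff)
    have nP: "n \<in> index P" using n_I I_index by blast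
    have s: "s \<ge> 0" using yb nP by (simp add: s_def body_iff)
    have val: "conormal P m \<bullet> y' = conormal P m \<bullet> y - (if m = l then s else if m = n then - s else 0)"
      if "m \<in> index P" for m
      using xi[OF l(1) that] by (simp add: y'_def inner_diff_right)
    have "conormal P m \<bullet> y' \<le> supp P m" if m: "m \<in> index P" for m
    proof -
      have "conormal P m \<bullet> y \<le> supp P m" using yb m by (simp add: body_iff)
      then show ?thesis using val[OF m] s by (auto simp: s_def)
    qed
    moreover have "y' \<in> vspace P"
      unfolding y'_def using yb xi_vspace[OF l(1)]
      by (intro subspace_diff subspace_scale subspace_P) (auto simp: body_iff)
    moreover have "conormal P m \<bullet> y' = supp P m" if m: "m \<in> J \<union> K" for m
    proof -
      have mP: "m \<in> index P" "m \<noteq> l" using m J K I_index l by auto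
      show ?thesis
      proof (cases "m = n")
        case True
        then show ?thesis using val[OF mP(1)] mP(2) by (simp add: s_def)
      next
        case False
        then have "m \<in> J \<union> (I - {n})" using m K by blast
        then have "conormal P m \<bullet> y = supp P m" using y by (simp add: face_iff)
        then show ?thesis using val[OF mP(1)] mP(2) False by simp
      qed
    qed
    ultimately have "y' \<in> face P (J \<union> K)" by (simp add: face_iff body_iff)
    then show ?thesis by blast
  qed
qed

lemma bundle_combinatorial_equivalence:
  assumes empty: "face P I = {}"
  shows "combinatorial_equivalence (product_presentation Q base_simplex) P (case_sum id id)"
  unfolding combinatorial_equivalence_def
proof (intro conjI allI impI)
  have ind: "index (product_presentation Q base_simplex) = (index P - I) <+> I"
    using index_Q empty by (simp add: product_presentation_def base_simplex_sel)
  show "bij_betw (case_sum id id) (index (product_presentation Q base_simplex)) (index P)"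
    unfolding ind
    by (rule bij_betw_byWitness[where f' = "\<lambda>i. if i \<in> I then Inr i else Inl i"])
      (use I_index in \<open>auto split: sum.splits\<close>)
  fix J assume J: "J \<subseteq> index (product_presentation Q base_simplex)"
  define J1 where "J1 = Inl -` J"
  define J2 where "J2 = Inr -` J"
  have J12: "J1 \<subseteq> index P - I" "J2 \<subseteq> I" using J unfolding ind J1_def J2_def by auto
  have "case_sum id id ` J = J1 \<union> J2"
  proof (intro subset_antisym subsetI)
    fix x assume "x \<in> case_sum id id ` J"
    then obtain z where "z \<in> J" "x = case_sum id id z" by blast
    then show "x \<in> J1 \<union> J2" by (cases z) (auto simp: J1_def J2_def)
  next
    fix x assume "x \<in> J1 \<union> J2"
    then show "x \<in> case_sum id id ` J" by (force simp: J1_def J2_def image_iff)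
  qed
  moreover have "face Q J1 \<noteq> {} \<longleftrightarrow> face P (J1 \<union> (I - {n})) \<noteq> {}"
  proof -
    obtain p where p: "p \<in> face P (I - {n})" "\<And>i. supp Q i = supp P i - conormal P i \<bullet> p"
      by (rule supp_face_presentation[OF face_I'_nonempty]) blast
    note bQ = body_face_presentation[OF subspace_P finite_index p]
    have face_iff_shift: "x \<in> face Q J1 \<longleftrightarrow> p + x \<in> face P (J1 \<union> (I - {n}))" for x
    proof (cases "x \<in> body Q")
      case True
      then have "conormal Q j \<bullet> x = conormal P j \<bullet> x" for j
        using conormal_face_presentation_inner[OF subspace_P] by (simp add: body_iff)
      then show ?thesis using True bQ[of x]
        by (auto simp: face_iff p(2) inner_add_right algebra_simps)
    next
      case False
      then show ?thesis using bQ[of x] by (auto simp: face_iff)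
    qed
    show ?thesis
    proof
      assume "face P (J1 \<union> (I - {n})) \<noteq> {}"
      then obtain y where "y \<in> face P (J1 \<union> (I - {n}))" by blast
      then have "y - p \<in> face Q J1" by (simp add: face_iff_shift)
      then show "face Q J1 \<noteq> {}" by blast
    qed (use face_iff_shift in blast)
  qed
  ultimately show "face (product_presentation Q base_simplex) J \<noteq> {} \<longleftrightarrow>
      face P (case_sum id id ` J) \<noteq> {}"
    using faces_of_bundle[OF empty J12] face_base_simplex[OF J12(2)]
    by (simp add: face_product_presentation times_eq_iff flip: J1_def J2_def)
qed

lemma bundle_over_simplex:
  assumes empty: "face P I = {}"
  shows "is_bundle P Q base_simplex I"
proof -
  have "I \<noteq> {n}"
  proof
    assume "I = {n}"
    then have "facet P n = {}" using empty by (simp add: face_singleton)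
    then show False using polytope_facet_nonempty[OF polytope_P] n_I I_index by blast
  qed
  then have simp: "is_simple_or_smooth base_simplex"
    using simplex_base_simplex by (simp add: is_simplex_def)
  have inj: "inj_on fibre_part (vspace Q)" by (rule inj_on_inverseI[where g = res]) (rule res_fibre_part)
  have se: "short_exact (vspace Q) (vspace P) (vspace base_simplex) fibre_part base_part"
    using inj fibre_part_image base_part_image by (simp add: short_exact_def base_simplex_sel)
  have sel: "short_exact (res ` L) L (int_span (conormal P ` (I - {n}))) fibre_part base_part"
    if L: "vlattice P = Some L" for L
    unfolding short_exact_def
  proof (intro conjI)
    note l = lattice[OF L] and lp = lattice_parts[OF L]
    show "inj_on fibre_part (res ` L)" by (rule inj_on_subset[OF inj]) (use res_vspace in blast)
    have fr: "fibre_part (res v) = fibre_part v" if "v \<in> L" for v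
      using that l(1) by (intro fibre_part_res) blast
    show "fibre_part ` res ` L = {v \<in> L. base_part v = 0}"
    proof (intro subset_antisym subsetI)
      fix v assume "v \<in> {v \<in> L. base_part v = 0}"
      then have v: "v \<in> L" "fibre_part v = v" by (auto simp: fibre_part_def)
      then have "v = fibre_part (res v)" using fr by simp
      then show "v \<in> fibre_part ` res ` L" using v(1) by blast
    qed (use fr lp(2) base_part_fibre_part in auto)
    show "base_part ` L = int_span (conormal P ` (I - {n}))"
    proof (intro subset_antisym subsetI)
      fix w assume w: "w \<in> int_span (conormal P ` (I - {n}))"
      then obtain c where "w = (\<Sum>b\<in>conormal P ` (I - {n}). real_of_int (c b) *\<^sub>R b)"
        by (auto simp: int_span_def)
      then have "w \<in> L" using l(5)[of "conormal P ` (I - {n})" "\<lambda>b. b" "\<lambda>b. real_of_int (c b)"] l(2) I_index by auto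
      moreover have "base_part w = w" using w int_span_subset_span by (intro base_part_span) blast
      ultimately show "w \<in> base_part ` L" by (metis imageI)
    qed (use lp(3) in auto)
  qed
  have "is_bundle_recorded P Q base_simplex I"
    unfolding is_bundle_recorded_def
  proof (rule exI[of _ fibre_part], rule exI[of _ base_part], rule exI[of _ "case_sum id id"], intro conjI)
    show "case (vlattice Q, vlattice P, vlattice base_simplex) of (None, None, None) \<Rightarrow> True
        | (Some LQ, Some LP, Some LR) \<Rightarrow> short_exact LQ LP LR fibre_part base_part
        | _ \<Rightarrow> False"
      using sel by (cases "vlattice P") (simp_all add: vlattice_face_presentation base_simplex_sel)
    show "\<forall>j\<in>index Q. conormal P (case_sum id id (Inl j)) = fibre_part (conormal Q j)"
      using index_Q empty by (simp add: fibre_part_conormal_Q fibre_part_conormal_other)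
  qed (use se linear_fibre_part linear_base_part bundle_combinatorial_equivalence[OF empty]
      base_part_conormal_simplex in \<open>simp_all add: base_simplex_sel comp_def\<close>)
  then show ?thesis
    unfolding is_bundle_def
    using simple_or_smooth simple_or_smooth_Q simp self_in_conormal_choices by blast
qed

end

text \<open>All members of a class are equivalent to one member \<open>i0\<close>; the vectors that separate \<open>i0\<close> from
  \<open>n\<close> and from \<open>j\<close> differ by one that separates \<open>n\<close> from \<open>j\<close>.\<close>

lemma facet_class_separated:
  fixes P :: "('i, 'a::euclidean_space) presentation"
  assumes P: "is_simple_or_smooth P" "is_normalized P" and I: "I \<in> facet_classes P" and n: "n \<in> I"
  obtains \<xi> where "separated_facets P I n \<xi>"
proof -
  let ?sep = "\<lambda>i j x. x \<in> vspace P \<and>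
    (\<forall>m\<in>index P. conormal P m \<bullet> x = (if m = j then 1 else 0) - (if m = i then 1 else 0))"
  have T: "subspace (vspace P)"
    using P(1) by (auto simp: is_simple_or_smooth_def is_smooth_def is_simple_def is_polytope_def
        split: option.splits)
  obtain i0 where i0: "i0 \<in> index P" "I = {j \<in> index P. equivalent_facets P i0 j}"
    using I by (auto simp: facet_classes_def quotient_def)
  have sep0: "\<exists>x. ?sep i0 j x" if j: "j \<in> I" for j
  proof (cases "j = i0")
    case True
    then show ?thesis using subspace_0[OF T] by (intro exI[of _ 0]) simp
  next
    case False
    then obtain x where x: "x \<in> vspace P" "conormal P i0 \<bullet> x = 1" "conormal P j \<bullet> x = -1"
        "\<And>m. m \<in> index P \<Longrightarrow> m \<noteq> i0 \<Longrightarrow> m \<noteq> j \<Longrightarrow> conormal P m \<bullet> x = 0"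
      using equivalent_facets_separating_vector[OF P, of i0 j] i0 j by auto
    then show ?thesis using False subspace_neg[OF T] by (intro exI[of _ "- x"]) auto
  qed
  obtain x where x: "\<And>j. j \<in> I \<Longrightarrow> ?sep i0 j (x j)" using sep0 by metis
  have "separated_facets P I n (\<lambda>j. x j - x n)"
  proof
    fix j assume j: "j \<in> I - {n}"
    show "x j - x n \<in> vspace P" using x j n subspace_diff[OF T] by blast
    fix m assume "m \<in> index P"
    then show "conormal P m \<bullet> (x j - x n) = (if m = j then 1 else if m = n then - 1 else 0)"
      using x[of j] x[OF n] j by (auto simp: inner_diff_right)
  qed (use P i0 n in auto)
  then show ?thesis by (rule that)
qed

theorem proposition3p17:
  fixes P :: "(nat, 'a::euclidean_space) presentation" and N n :: nat and I :: "nat set"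
  assumes "index P = {1..N}"
    and "is_simple_or_smooth P"
    and "is_normalized P"
    and "I \<in> facet_classes P"
    and "n \<in> I"
  shows "(face P I = {} \<longrightarrow>
            (\<exists>R :: (nat, 'a) presentation.
               is_simplex (card I - 1) R \<and>
               is_bundle P (face_presentation P (I - {n})) R I)) \<and>
         (face P I \<noteq> {} \<longrightarrow>
            is_expansion (card I - 1) P (face_presentation P (I - {n})) n I)"
proof -
  obtain \<xi> where "separated_facets P I n \<xi>"
    by (rule facet_class_separated[OF assms(2-5)])
  then interpret separated_facets P I n \<xi> .
  show ?thesis
  proof (intro conjI impI)
    assume empty: "face P I = {}"
    have "I \<noteq> {n}"
      using empty polytope_facet_nonempty[OF polytope_P] n_I I_index by (auto simp: face_singleton)
    then show "\<exists>R :: (nat, 'a) presentation. is_simplex (card I - 1) R \<and>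
        is_bundle P (face_presentation P (I - {n})) R I"
      using simplex_base_simplex bundle_over_simplex[OF empty] by blast
  qed (rule expansion_along_facet)
qed

end
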